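(* Let $\boldsymbol{T}$ be Hermitian, let $\lambda$ be a non-zero real number, and let $\{\mu_n\}_{n=1}^\infty$ be a decreasing sequence of positive real numbers with $\lim_{n\to\infty}\mu_n=0$. Then a strictly increasing sequence $\{m_n\}_{n=1}^\infty$ of positive integers can be found (in terms of $\boldsymbol{T}$) along which, as $n\to\infty$, $$-\imath\mu_n\widetilde{\boldsymbol{t}}_{m_n|\lambda+\imath\mu_n}\to\boldsymbol{e}_{|\{\frac1\lambda\}}\quad\text{in }C(\mathbb{R},L^2),$$ $$\imath\mu_n\widetilde{\boldsymbol{T}}_{m_n|\lambda+\imath\mu_n}\to\boldsymbol{E}_{|\{\frac1\lambda\}}\quad\text{in }C(\mathbb{R}^2,\mathbb{C}),$$ and along which, therefore, the limit $\lim_{n\to\infty}\mu_n\|\widetilde{\boldsymbol{T}}_{m_n|\lambda+\imath\mu_n}\|_{C(\mathbb{R}^2,\mathbb{C})}$ exists, and is equal to zero if and only if $\lambda\in\Lambda_c(T)\cup\Pi(T)$, and greater than zero if and only if $\lambda\in\Lambda_p(T)$. For example, as such a sequence of indices one can always take a strictly increasing sequence $\{m_n\}_{n=1}^\infty$ of positive integers satisfying $$\lim_{n\to\infty}\ \sup_{s\in\mathbb{I}_{m_n}}\int_{\widehat{\mathbb{I}}_{m_n}}\left|\int_{\mathbb{I}_{m_n}}\boldsymbol{T}(t,\xi)\,\overline{\widetilde{\boldsymbol{T}}_{m_n|\lambda+\imath\mu_n}(s,\xi)}\,d\xi\right|^2dt=0.$$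
   Context: $\imath$ is the imaginary unit. $L^2=L^2(\mathbb{R})$ is the complex Hilbert space with inner product $\langle f,g\rangle=\int f(s)\overline{g(s)}\,ds$ (integrals without indicated domain are over $\mathbb{R}$, Lebesgue measure) and norm $\|\cdot\|$; $\mathfrak{R}(L^2)$ is the algebra of bounded linear operators $L^2\to L^2$. For a Banach space $B$ and $k\in\mathbb{N}$, $C(\mathbb{R}^k,B)$ is the Banach space, with the sup-norm, of continuous functions $f:\mathbb{R}^k\to B$ with $\|f(x)\|_B\to0$ as $|x|\to\infty$. $K^0$-kernels: a measurable function $\boldsymbol{K}:\mathbb{R}^2\to\mathbb{C}$, square integrable in each variable for almost every value of the other, is a $K^0$-kernel if (i) $\boldsymbol{K}\in C(\mathbb{R}^2,\mathbb{C})$; (ii) the Carleman function $\boldsymbol{k}(s)=\overline{\boldsymbol{K}(s,\cdot)}$ is in $C(\mathbb{R},L^2)$; (iii) the Carleman function $\boldsymbol{k}'(s)=\boldsymbol{K}(\cdot,s)$ is in $C(\mathbb{R},L^2)$. A kernel $\boldsymbol{K}$ induces (is the kernel of) $K\in\mathfrak{R}(L^2)$ if $(Kf)(s)=\int\boldsymbol{K}(s,t)f(t)\,dt$ for every $f\in L^2$ and almost every $s$. Standing assumptions: $\boldsymbol{T}$ is a $K^0$-kernel inducing an operator $T\in\mathfrak{R}(L^2)$, and there are positive reals $\tau_n$ ($n\in\mathbb{N}$), strictly increasing to $\infty$, such that, with $\mathbb{I}_n=(-\tau_n,\tau_n)$, $\widehat{\mathbb{I}}_n=\mathbb{R}\setminus\mathbb{I}_n$,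 $\chi_n$ the characteristic function of $\mathbb{I}_n$ and $P_nf=\chi_nf$, for each $n$ the subkernels $\boldsymbol{T}_n(s,t)=\chi_n(s)\boldsymbol{T}(s,t)$ and $\widetilde{\boldsymbol{T}}_n(s,t)=\chi_n(s)\boldsymbol{T}(s,t)\chi_n(t)$ are $K^0$-kernels and the operators they induce, $T_n=P_nT$ and $\widetilde{T}_n=P_nTP_n$, are nuclear. Hermitian means $\boldsymbol{T}(s,t)=\overline{\boldsymbol{T}(t,s)}$ for all $s,t\in\mathbb{R}$; then $T$ and all $\widetilde{T}_n$ are self-adjoint. For $S\in\mathfrak{R}(L^2)$, $\Pi(S)$ (regular values) is the set of $\lambda\in\mathbb{C}$ for which $I-\lambda S$ has an inverse in $\mathfrak{R}(L^2)$; for $\lambda\in\Pi(S)$ the Fredholm resolvent is $S_{|\lambda}=S(I-\lambda S)^{-1}$. If $S$ is induced by a $K^0$-kernel $\boldsymbol{S}$ and $\lambda\in\Pi(S)$, the resolvent kernel $\boldsymbol{S}_{|\lambda}$ is the (existing and unique) $K^0$-kernel inducing $S_{|\lambda}$. Thus $\widetilde{\boldsymbol{T}}_{m|\zeta}$ is the resolvent kernel for $\widetilde{\boldsymbol{T}}_m$ at $\zeta\in\Pi(\widetilde{T}_m)$, and $\widetilde{\boldsymbol{t}}_{m|\zeta}(s)=\overline{\widetilde{\boldsymbol{T}}_{m|\zeta}(s,\cdot)}$. The characteristic set is $\Lambda(T)=\mathbb{C}\setminus\Pi(T)$, with $\Lambda_p(T)=\{\lambda\in\Lambda(T):\operatorname{Ker}(I-\lambda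 T)\ne\{0\}\}$ and $\Lambda_c(T)=\{\lambda\in\Lambda(T):\operatorname{Ker}(I-\lambda T)=\{0\},\ \overline{\operatorname{Ran}(I-\lambda T)}=L^2\}$. $E_T(\cdot)$ is the resolution of the identity (projection-valued spectral measure on Borel subsets of $\mathbb{R}$) of the self-adjoint operator $T$. For a Borel set $\omega\subset\mathbb{R}$ whose closure does not contain $0$, $\boldsymbol{E}_{|\omega}$ (the value at $\omega$ of the spectral function for $\boldsymbol{T}$) is the $K^0$-kernel inducing the orthogonal projection $E_T(\omega)$, and $\boldsymbol{e}_{|\omega}(s)=\overline{\boldsymbol{E}_{|\omega}(s,\cdot)}$; explicitly $\boldsymbol{e}_{|\omega}(s)=v_\omega(T)(\boldsymbol{t}(s))$ with $v_\omega(x)=1/x$ for $x\in\omega$ and $v_\omega(x)=0$ otherwise, $\boldsymbol{t}(s)=\overline{\boldsymbol{T}(s,\cdot)}$, and $\boldsymbol{E}_{|\omega}(s,t)=\langle\boldsymbol{e}_{|\omega}(t),\boldsymbol{e}_{|\omega}(s)\rangle$.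
   Formalization: The two prefactors carry the opposite sign: iμ_n t̃ → e and −iμ_n T̃ → E are proved; with S_{|λ}=S(I−λS)^{-1} the printed signs give −e and −E, so the printed limits fail whenever λ ∈ Λ_p(T). *)

theory Defs
  imports "HOL-Analysis.Analysis"
begin

section \<open>The complex Hilbert space of square-integrable functions on the line\<close>

definition sq_integrable :: "(real \<Rightarrow> complex) \<Rightarrow> bool" where
  "sq_integrable f \<longleftrightarrow>
     f \<in> borel_measurable lborel \<and> integrable lborel (\<lambda>x. (cmod (f x))\<^sup>2)"

lemma sq_integrable_zero: "sq_integrable (\<lambda>_. 0)"
  by (simp add: sq_integrable_def)

lemma sq_integrable_cmult: "sq_integrable f \<Longrightarrow> sq_integrable (\<lambda>x. c * f x)"
  by (auto simp: sq_integrable_def norm_mult power_mult_distrib)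

lemma sq_integrable_add:
  assumes "sq_integrable f" "sq_integrable g"
  shows "sq_integrable (\<lambda>x. f x + g x)"
proof -
  have m [measurable]: "f \<in> borel_measurable borel" "g \<in> borel_measurable borel"
    using assms by (auto simp: sq_integrable_def)
  have "integrable lborel (\<lambda>x. 2 * (cmod (f x))\<^sup>2 + 2 * (cmod (g x))\<^sup>2)"
    using assms by (auto simp: sq_integrable_def)
  then have "integrable lborel (\<lambda>x. (cmod (f x + g x))\<^sup>2)"
  proof (rule Bochner_Integration.integrable_bound)
    have "(cmod (a + b))\<^sup>2 \<le> 2 * (cmod a)\<^sup>2 + 2 * (cmod b)\<^sup>2" for a b
    proof -
      have "(cmod (a + b))\<^sup>2 \<le> (cmod a + cmod b)\<^sup>2"
        by (intro power_mono norm_triangle_ineq) auto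
      also have "\<dots> \<le> 2 * (cmod a)\<^sup>2 + 2 * (cmod b)\<^sup>2"
        using sum_squares_bound[of "cmod a" "cmod b"] by (simp add: power2_sum)
      finally show ?thesis .
    qed
    then show "AE x in lborel. norm ((cmod (f x + g x))\<^sup>2)
        \<le> norm (2 * (cmod (f x))\<^sup>2 + 2 * (cmod (g x))\<^sup>2)"
      by (auto intro!: AE_I2 order_trans[OF _ abs_ge_self])
  qed simp
  then show ?thesis
    by (simp add: sq_integrable_def)
qed

lemma sq_integrable_indicator:
  assumes "sq_integrable f" "A \<in> sets borel"
  shows "sq_integrable (\<lambda>x. indicator A x * f x)"
proof -
  have m [measurable]: "f \<in> borel_measurable borel" "A \<in> sets borel"
    using assms by (auto simp: sq_integrable_def)
  have "integrable lborel (\<lambda>x. (cmod (f x))\<^sup>2)"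
    using assms by (auto simp: sq_integrable_def)
  then have "integrable lborel (\<lambda>x. (cmod (indicator A x * f x))\<^sup>2)"
    by (rule Bochner_Integration.integrable_bound) (auto simp: indicator_def)
  then show ?thesis
    by (simp add: sq_integrable_def)
qed

lemma borel_measurable_cnj [measurable (raw)]:
  "f \<in> borel_measurable M \<Longrightarrow> (\<lambda>x. cnj (f x)) \<in> borel_measurable M"
  by (rule measurable_compose[OF _ borel_measurable_continuous_onI])
    (auto intro: continuous_intros)

lemma sq_integrable_mult_cnj:
  assumes "sq_integrable f" "sq_integrable g"
  shows "integrable lborel (\<lambda>x. f x * cnj (g x))"
proof -
  have m [measurable]: "f \<in> borel_measurable borel" "g \<in> borel_measurable borel"
    using assms by (auto simp: sq_integrable_def)
  have "integrable lborel (\<lambda>x. (cmod (f x))\<^sup>2 + (cmod (g x))\<^sup>2)"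
    using assms by (auto simp: sq_integrable_def)
  then show ?thesis
  proof (rule Bochner_Integration.integrable_bound)
    have "cmod a * cmod b \<le> (cmod a)\<^sup>2 + (cmod b)\<^sup>2" for a b
    proof -
      have "2 * (cmod a * cmod b) \<le> (cmod a)\<^sup>2 + (cmod b)\<^sup>2"
        using sum_squares_bound[of "cmod a" "cmod b"] by (simp add: mult.assoc)
      moreover have "0 \<le> cmod a * cmod b" by simp
      ultimately show ?thesis by linarith
    qed
    then show "AE x in lborel. norm (f x * cnj (g x))
        \<le> norm ((cmod (f x))\<^sup>2 + (cmod (g x))\<^sup>2)"
      by (auto simp: norm_mult intro!: AE_I2)
  qed simp
qed

quotient_type L2 = "real \<Rightarrow> complex" / partial:
  "\<lambda>f g. sq_integrable f \<and> sq_integrable g \<and> (AE x in lborel. f x = g x)"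
  morphisms rep_L2 abs_L2
proof (rule part_equivpI)
  show "\<exists>x. sq_integrable x \<and> sq_integrable x \<and> (AE t in lborel. x t = x t)"
    using sq_integrable_zero by auto
  show "symp (\<lambda>f g. sq_integrable f \<and> sq_integrable g \<and> (AE x in lborel. f x = g x))"
    by (auto intro!: sympI elim: AE_mp)
  show "transp (\<lambda>f g. sq_integrable f \<and> sq_integrable g \<and> (AE x in lborel. f x = g x))"
    by (auto intro!: transpI elim: AE_mp)
qed

lift_definition cscale :: "complex \<Rightarrow> L2 \<Rightarrow> L2" (infixr "*\<^sub>C" 75) is "\<lambda>c f x. c * f x"
  by (auto intro: sq_integrable_cmult)

lift_definition cinner :: "L2 \<Rightarrow> L2 \<Rightarrow> complex" is
  "\<lambda>f g. \<integral>x. f x * cnj (g x) \<partial>lborel"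
  by (rule integral_cong_AE)
    (auto simp: sq_integrable_def intro!: borel_measurable_times borel_measurable_cnj)

lift_definition cutoff :: "real \<Rightarrow> L2 \<Rightarrow> L2" is
  "\<lambda>r f s. indicator {-r<..<r} s * f s"
  by (auto intro: sq_integrable_indicator)

instantiation L2 :: real_inner
begin

lift_definition zero_L2 :: L2 is "\<lambda>_. 0"
  by (simp add: sq_integrable_zero)

lift_definition plus_L2 :: "L2 \<Rightarrow> L2 \<Rightarrow> L2" is "\<lambda>f g x. f x + g x"
  by (auto intro: sq_integrable_add elim: AE_mp)

lift_definition uminus_L2 :: "L2 \<Rightarrow> L2" is "\<lambda>f x. - f x"
  by (auto simp: sq_integrable_def)

definition minus_L2 :: "L2 \<Rightarrow> L2 \<Rightarrow> L2" where "minus_L2 f g = f + - g"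

definition scaleR_L2 :: "real \<Rightarrow> L2 \<Rightarrow> L2" where "scaleR_L2 r f = complex_of_real r *\<^sub>C f"

definition inner_L2 :: "L2 \<Rightarrow> L2 \<Rightarrow> real" where "inner_L2 f g = Re (cinner f g)"

definition norm_L2 :: "L2 \<Rightarrow> real" where "norm_L2 f = sqrt (inner f f)"

definition sgn_L2 :: "L2 \<Rightarrow> L2" where "sgn_L2 f = inverse (norm f) *\<^sub>R f"

definition dist_L2 :: "L2 \<Rightarrow> L2 \<Rightarrow> real" where "dist_L2 f g = norm (f - g)"

definition uniformity_L2 :: "(L2 \<times> L2) filter" where
  "uniformity_L2 = (INF e\<in>{0<..}. principal {(x, y). dist x y < e})"

definition open_L2 :: "L2 set \<Rightarrow> bool" where
  "open_L2 U \<longleftrightarrow> (\<forall>x\<in>U. \<forall>\<^sub>F (x', y) in uniformity. x' = x \<longrightarrow> y \<in> U)"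

instance
proof
  fix x y z :: L2 and a b :: real
  show "x + y + z = x + (y + z)"
    by transfer (auto intro: sq_integrable_add simp: add.assoc)
  show "x + y = y + x"
    by transfer (auto intro: sq_integrable_add simp: add.commute)
  show "0 + x = x"
    by transfer auto
  show "- x + x = 0"
    by transfer (auto simp: sq_integrable_zero)
  show "x - y = x + - y"
    by (simp add: minus_L2_def)
  show "a *\<^sub>R (x + y) = a *\<^sub>R x + a *\<^sub>R y"
    unfolding scaleR_L2_def
    by transfer (auto intro!: sq_integrable_add sq_integrable_cmult simp: distrib_left)
  show "(a + b) *\<^sub>R x = a *\<^sub>R x + b *\<^sub>R x"
    unfolding scaleR_L2_def
    by transfer (auto intro!: sq_integrable_add sq_integrable_cmult simp: distrib_right)
  show "a *\<^sub>R b *\<^sub>R x = (a * b) *\<^sub>R x"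
    unfolding scaleR_L2_def
    by transfer (auto intro!: sq_integrable_cmult simp: mult.assoc)
  show "1 *\<^sub>R x = x"
    unfolding scaleR_L2_def by transfer auto
  show "sgn x = inverse (norm x) *\<^sub>R x"
    by (rule sgn_L2_def)
  show "dist x y = norm (x - y)"
    by (rule dist_L2_def)
  show "uniformity = (INF e\<in>{0<..}. principal {(x, y). dist (x::L2) y < e})"
    by (rule uniformity_L2_def)
  show "open U \<longleftrightarrow> (\<forall>x\<in>U. \<forall>\<^sub>F (x', y) in uniformity. x' = x \<longrightarrow> y \<in> U)" for U :: "L2 set"
    by (rule open_L2_def)
  show "norm x = sqrt (inner x x)"
    by (rule norm_L2_def)
  have re: "Re (\<integral>x. f x * cnj (g x) \<partial>lborel) = (\<integral>x. Re (f x * cnj (g x)) \<partial>lborel)"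
    if "sq_integrable f" "sq_integrable g" for f g
    using integral_Re[OF sq_integrable_mult_cnj[OF that]] by simp
  show "inner x y = inner y x"
    unfolding inner_L2_def
    by transfer (auto simp: re intro!: Bochner_Integration.integral_cong)
  show "inner (x + y) z = inner x z + inner y z"
    unfolding inner_L2_def
    by transfer (simp add: distrib_right Bochner_Integration.integral_add sq_integrable_mult_cnj)
  show "inner (a *\<^sub>R x) y = a * inner x y"
    unfolding inner_L2_def scaleR_L2_def
    by transfer (simp add: mult.assoc)
  have sq: "Re (\<integral>x. f x * cnj (f x) \<partial>lborel) = (\<integral>x. (cmod (f x))\<^sup>2 \<partial>lborel)"
    if "sq_integrable f" for f
    using re[OF that that] by (simp add: complex_mult_cnj cmod_power2)
  show "0 \<le> inner x x"
    unfolding inner_L2_def by transfer (auto simp: sq)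
  show "inner x x = 0 \<longleftrightarrow> x = 0"
    unfolding inner_L2_def
  proof transfer
    fix f assume "sq_integrable f \<and> sq_integrable f \<and> (AE x in lborel. f x = f x)"
    then have f: "sq_integrable f" by simp
    then have "(\<integral>x. (cmod (f x))\<^sup>2 \<partial>lborel) = 0 \<longleftrightarrow> (AE x in lborel. (cmod (f x))\<^sup>2 = 0)"
      by (intro integral_nonneg_eq_0_iff_AE) (auto simp: sq_integrable_def)
    then show "Re (\<integral>x. f x * cnj (f x) \<partial>lborel) = 0 \<longleftrightarrow>
        sq_integrable f \<and> sq_integrable (\<lambda>_. 0) \<and> (AE x in lborel. f x = 0)"
      using f by (simp add: sq sq_integrable_zero)
  qed
qed

end


section \<open>Operators\<close>

definition bounded_op :: "(L2 \<Rightarrow> L2) \<Rightarrow> bool" where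
  "bounded_op A \<longleftrightarrow> bounded_linear A \<and> (\<forall>c f. A (c *\<^sub>C f) = c *\<^sub>C A f)"

definition nuclear :: "(L2 \<Rightarrow> L2) \<Rightarrow> bool" where
  "nuclear A \<longleftrightarrow> (\<exists>\<phi> \<psi> :: nat \<Rightarrow> L2.
     summable (\<lambda>k. norm (\<phi> k) * norm (\<psi> k)) \<and>
     (\<forall>f. (\<lambda>k. cinner f (\<phi> k) *\<^sub>C \<psi> k) sums A f))"

definition fredholm :: "(L2 \<Rightarrow> L2) \<Rightarrow> complex \<Rightarrow> L2 \<Rightarrow> L2" where
  "fredholm A l = (\<lambda>f. f - l *\<^sub>C A f)"

definition regular_values :: "(L2 \<Rightarrow> L2) \<Rightarrow> complex set" where
  "regular_values A =
     {l. \<exists>R. bounded_op R \<and> R \<circ> fredholm A l = id \<and> fredholm A l \<circ> R = id}"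

definition fredholm_resolvent :: "(L2 \<Rightarrow> L2) \<Rightarrow> complex \<Rightarrow> L2 \<Rightarrow> L2" where
  "fredholm_resolvent A l = A \<circ> inv (fredholm A l)"

definition characteristic_set :: "(L2 \<Rightarrow> L2) \<Rightarrow> complex set" where
  "characteristic_set A = - regular_values A"

definition point_characteristic_set :: "(L2 \<Rightarrow> L2) \<Rightarrow> complex set" where
  "point_characteristic_set A =
     {l \<in> characteristic_set A. {f. fredholm A l f = 0} \<noteq> {0}}"

definition continuous_characteristic_set :: "(L2 \<Rightarrow> L2) \<Rightarrow> complex set" where
  "continuous_characteristic_set A =
     {l \<in> characteristic_set A. {f. fredholm A l f = 0} = {0} \<and>
        closure (range (fredholm A l)) = UNIV}"

definition orthogonal_projection :: "(L2 \<Rightarrow> L2) \<Rightarrow> bool" where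
  "orthogonal_projection P \<longleftrightarrow>
     bounded_op P \<and> P \<circ> P = P \<and> (\<forall>f g. cinner (P f) g = cinner f (P g))"

definition spectral_distribution :: "(real set \<Rightarrow> L2 \<Rightarrow> L2) \<Rightarrow> L2 \<Rightarrow> real measure" where
  "spectral_distribution E f =
     measure_of UNIV (sets borel) (\<lambda>\<omega>. ennreal (Re (cinner (E \<omega> f) f)))"

text \<open>
  \<open>E\<close> is the projection-valued spectral measure of the self-adjoint operator \<open>A\<close>: it is
  strongly countably additive and represents \<open>A\<close> as the integral of the identity function,
  expressed through the quadratic forms of \<open>A\<close> and \<open>E\<close>. These conditions determine \<open>E\<close> on
  the Borel sets; nothing is required of \<open>E\<close> elsewhere.
\<close>

definition resolution_of_identity :: "(L2 \<Rightarrow> L2) \<Rightarrow> (real set \<Rightarrow> L2 \<Rightarrow> L2) \<Rightarrow> bool" where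
  "resolution_of_identity A E \<longleftrightarrow>
     (\<forall>\<omega>\<in>sets borel. orthogonal_projection (E \<omega>)) \<and>
     E {} = (\<lambda>_. 0) \<and> E UNIV = id \<and>
     (\<forall>\<omega>\<in>sets borel. \<forall>\<omega>'\<in>sets borel. E (\<omega> \<inter> \<omega>') = E \<omega> \<circ> E \<omega>') \<and>
     (\<forall>W :: nat \<Rightarrow> real set. range W \<subseteq> sets borel \<and> disjoint_family W \<longrightarrow>
        (\<forall>f. (\<lambda>n. E (W n) f) sums E (\<Union>n. W n) f)) \<and>
     (\<forall>f. integrable (spectral_distribution E f) (\<lambda>x. x) \<and>
        cinner (A f) f = complex_of_real (\<integral>x. x \<partial>spectral_distribution E f))"


section \<open>Continuous functions vanishing at infinity\<close>

definition C0 :: "('a::real_normed_vector \<Rightarrow> 'b::real_normed_vector) set" where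
  "C0 = {f. continuous_on UNIV f \<and> (f \<longlongrightarrow> 0) at_infinity}"

definition sup_norm :: "('a::real_normed_vector \<Rightarrow> 'b::real_normed_vector) \<Rightarrow> real" where
  "sup_norm f = (SUP x. norm (f x))"

definition C0_tendsto ::
  "(nat \<Rightarrow> 'a::real_normed_vector \<Rightarrow> 'b::real_normed_vector) \<Rightarrow> ('a \<Rightarrow> 'b) \<Rightarrow> bool" where
  "C0_tendsto F f \<longleftrightarrow>
     (\<forall>n. F n \<in> C0) \<and> f \<in> C0 \<and> (\<lambda>n. sup_norm (\<lambda>x. F n x - f x)) \<longlonglongrightarrow> 0"


section \<open>Kernels\<close>

definition carleman :: "(real \<Rightarrow> real \<Rightarrow> complex) \<Rightarrow> real \<Rightarrow> L2" where
  "carleman K s = abs_L2 (\<lambda>t. cnj (K s t))"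

definition carleman' :: "(real \<Rightarrow> real \<Rightarrow> complex) \<Rightarrow> real \<Rightarrow> L2" where
  "carleman' K s = abs_L2 (\<lambda>t. K t s)"

text \<open>
  The Carleman functions are required to be everywhere defined, so square integrability is
  demanded at every point and not merely almost everywhere.
\<close>

definition K0_kernel :: "(real \<Rightarrow> real \<Rightarrow> complex) \<Rightarrow> bool" where
  "K0_kernel K \<longleftrightarrow>
     case_prod K \<in> borel_measurable lborel \<and>
     (\<forall>s. sq_integrable (\<lambda>t. K s t)) \<and> (\<forall>t. sq_integrable (\<lambda>s. K s t)) \<and>
     case_prod K \<in> C0 \<and> carleman K \<in> C0 \<and> carleman' K \<in> C0"

definition induces :: "(real \<Rightarrow> real \<Rightarrow> complex) \<Rightarrow> (L2 \<Rightarrow> L2) \<Rightarrow> bool" where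
  "induces K A \<longleftrightarrow> bounded_op A \<and>
     (\<forall>f. AE s in lborel. rep_L2 (A f) s = (\<integral>t. K s t * rep_L2 f t \<partial>lborel))"

definition induced_op :: "(real \<Rightarrow> real \<Rightarrow> complex) \<Rightarrow> L2 \<Rightarrow> L2" where
  "induced_op K = (THE A. induces K A)"

definition hermitian_kernel :: "(real \<Rightarrow> real \<Rightarrow> complex) \<Rightarrow> bool" where
  "hermitian_kernel K \<longleftrightarrow> (\<forall>s t. K s t = cnj (K t s))"

definition kernel_inducing :: "(L2 \<Rightarrow> L2) \<Rightarrow> real \<Rightarrow> real \<Rightarrow> complex" where
  "kernel_inducing A = (THE K. K0_kernel K \<and> induces K A)"

definition resolvent_kernel ::
  "(real \<Rightarrow> real \<Rightarrow> complex) \<Rightarrow> complex \<Rightarrow> real \<Rightarrow> real \<Rightarrow> complex" where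
  "resolvent_kernel K l = kernel_inducing (fredholm_resolvent (induced_op K) l)"

definition spectral_kernel ::
  "(real set \<Rightarrow> L2 \<Rightarrow> L2) \<Rightarrow> real set \<Rightarrow> real \<Rightarrow> real \<Rightarrow> complex" where
  "spectral_kernel E \<omega> = kernel_inducing (E \<omega>)"

definition row_cut :: "real \<Rightarrow> (real \<Rightarrow> real \<Rightarrow> complex) \<Rightarrow> real \<Rightarrow> real \<Rightarrow> complex" where
  "row_cut r K s t = indicator {-r<..<r} s * K s t"

definition square_cut :: "real \<Rightarrow> (real \<Rightarrow> real \<Rightarrow> complex) \<Rightarrow> real \<Rightarrow> real \<Rightarrow> complex" where
  "square_cut r K s t = indicator {-r<..<r} s * K s t * indicator {-r<..<r} t"


section \<open>Limits of resolvent kernels along a sequence of truncations\<close>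

definition cut_resolvent ::
  "(real \<Rightarrow> real \<Rightarrow> complex) \<Rightarrow> (nat \<Rightarrow> real) \<Rightarrow> nat \<Rightarrow> complex \<Rightarrow> real \<Rightarrow> real \<Rightarrow> complex" where
  "cut_resolvent K \<tau> m l = resolvent_kernel (square_cut (\<tau> m) K) l"

text \<open>
  The supremum and the outer integral are taken in the extended non-negative reals.
\<close>

definition vanishing_tails ::
  "(real \<Rightarrow> real \<Rightarrow> complex) \<Rightarrow> (nat \<Rightarrow> real) \<Rightarrow> real \<Rightarrow> (nat \<Rightarrow> real) \<Rightarrow> (nat \<Rightarrow> nat) \<Rightarrow> bool" where
  "vanishing_tails K \<tau> l \<mu> m \<longleftrightarrow>
     (\<lambda>n. SUP s\<in>{- \<tau> (m n)<..<\<tau> (m n)}.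
        \<integral>\<^sup>+ t\<in>- {- \<tau> (m n)<..<\<tau> (m n)}.
          ennreal ((cmod (LINT \<xi>:{- \<tau> (m n)<..<\<tau> (m n)}|lborel.
             K t \<xi> * cnj (cut_resolvent K \<tau> (m n) (Complex l (\<mu> n)) s \<xi>)))\<^sup>2) \<partial>lborel)
     \<longlonglongrightarrow> 0"

text \<open>
  Signs: if \<open>A f = (1 / l) *\<^sub>C f\<close>, then the Fredholm resolvent of \<open>A\<close> at \<open>l + \<i> \<mu>\<close> multiplies
  \<open>f\<close> by \<open>(1 / l) / (1 - (l + \<i> \<mu>) / l) = \<i> / \<mu>\<close>. Hence the resolvent kernels must be
  multiplied by \<open>- \<i> \<mu>\<close>, and their Carleman functions, which carry a complex conjugation,
  by \<open>\<i> \<mu>\<close>, in order to produce the spectral kernel at \<open>{1 / l}\<close> and its Carleman function.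
\<close>

definition resolvents_converge ::
  "(real \<Rightarrow> real \<Rightarrow> complex) \<Rightarrow> (L2 \<Rightarrow> L2) \<Rightarrow> (real set \<Rightarrow> L2 \<Rightarrow> L2) \<Rightarrow> (nat \<Rightarrow> real) \<Rightarrow>
   real \<Rightarrow> (nat \<Rightarrow> real) \<Rightarrow> (nat \<Rightarrow> nat) \<Rightarrow> bool" where
  "resolvents_converge K A E \<tau> l \<mu> m \<longleftrightarrow>
     (let R = (\<lambda>n. cut_resolvent K \<tau> (m n) (Complex l (\<mu> n)));
          S = spectral_kernel E {1 / l}
      in C0_tendsto (\<lambda>n s. (\<i> * complex_of_real (\<mu> n)) *\<^sub>C carleman (R n) s) (carleman S) \<and>
         C0_tendsto (\<lambda>n (s, t). - \<i> * complex_of_real (\<mu> n) * R n s t) (\<lambda>(s, t). S s t) \<and>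
         (\<exists>L. (\<lambda>n. \<mu> n * sup_norm (\<lambda>(s, t). R n s t)) \<longlonglongrightarrow> L \<and>
            (L = 0 \<longleftrightarrow>
               complex_of_real l \<in> continuous_characteristic_set A \<union> regular_values A) \<and>
            (L > 0 \<longleftrightarrow> complex_of_real l \<in> point_characteristic_set A)))"

end

theory Submission
  imports Defs
begin

text \<open>
  Write \<open>k\<close> for the Carleman function of \<open>K\<close>, \<open>P\<^sub>m\<close> for the truncation to \<open>(- \<tau>\<^sub>m, \<tau>\<^sub>m)\<close>,
  \<open>z = l - \<i> \<mu>\<close> for the conjugate of the parameter, \<open>B = (I - z T)\<^sup>-\<^sup>1\<close>, and \<open>R(s)\<close> for the
  Carleman function of the resolvent kernel of \<open>P\<^sub>m T P\<^sub>m\<close> at \<open>l + \<i> \<mu>\<close>.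

  The theorem is an approximation of the known behaviour of the untruncated resolvent. For a
  self-adjoint \<open>T\<close> the operators \<open>\<i> \<mu> B\<close> are bounded by \<open>\<bar>z\<bar>\<close> and converge strongly to \<open>l Q\<close>
  as \<open>\<mu>\<close> tends to \<open>0\<close>, where \<open>Q\<close> is the spectral projection of the point \<open>1 / l\<close>: on the range of
  \<open>Q\<close> this is an identity, and on spectral subspaces at positive distance from \<open>1 / l\<close> the operators
  \<open>B\<close> stay bounded (\<open>scaled_resolvent_tendsto\<close>). Since \<open>k\<close> is continuous and vanishes at infinity,
  its range is relatively compact, so \<open>\<i> \<mu> B k(s)\<close> converges to \<open>l Q k(s)\<close> uniformly in \<open>s\<close>
  (\<open>uniform_limit_strong_C0\<close>), and \<open>l Q k\<close> is the Carleman function of the spectral kernel.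

  For \<open>s\<close> in the truncation interval, \<open>R(s) = z P\<^sub>m T R(s) + P\<^sub>m k(s)\<close>, hence
  \<open>(I - z T) R(s) = P\<^sub>m k(s) - z (I - P\<^sub>m) T R(s)\<close>. The norm of \<open>(I - P\<^sub>m) T R(s)\<close> is the square root of
  the double integral in the tail condition (\<open>tail_integral\<close>). Applying \<open>\<i> \<mu> B\<close> shows that
  \<open>\<i> \<mu> R(s) - \<i> \<mu> B k(s)\<close> tends to \<open>0\<close> uniformly as soon as the tails do (\<open>cut_resolvent_diff_le\<close>).
  The kernels themselves follow from the identity that expresses the resolvent kernel at \<open>(s, t)\<close>
  through the inner product of \<open>P\<^sub>m k(t)\<close> with \<open>R(s)\<close>. That tails can be made to vanish is a matter of
  choosing \<open>m\<close> large for each \<open>n\<close>: for a fixed nonreal parameter \<open>R(s)\<close> converges to \<open>B k(s)\<close>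
  uniformly as \<open>m\<close> grows (\<open>cut_resolvent_tail_le\<close>).

  Finally the limit of the scaled sup-norms is the sup-norm of the spectral kernel, which vanishes
  exactly when \<open>Q = 0\<close>, that is, when \<open>1 / l\<close> is not an eigenvalue. In that case
  \<open>f = lim (I - l T) B f\<close> for every \<open>f\<close>, so \<open>I - l T\<close> has dense range (\<open>dense_range_of_trivial_atom\<close>).
\<close>

section \<open>The Hilbert space of square-integrable functions\<close>

lemma sq_integrable_rep: "sq_integrable (rep_L2 f)"
  using Quotient_rep_reflp[OF Quotient_L2] by blast

lemma abs_rep_L2: "abs_L2 (rep_L2 f) = f"
  by (rule Quotient_abs_rep[OF Quotient_L2])

lemma rep_abs_L2: "sq_integrable f \<Longrightarrow> AE x in lborel. rep_L2 (abs_L2 f) x = f x"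
  using Quotient_rep_abs[OF Quotient_L2, of f] by auto

lemma L2_eqI:
  assumes "AE x in lborel. rep_L2 f x = rep_L2 g x"
  shows "f = g"
proof -
  have "abs_L2 (rep_L2 f) = abs_L2 (rep_L2 g)"
    by (rule Quotient_rel_abs[OF Quotient_L2]) (simp add: assms sq_integrable_rep)
  then show ?thesis by (simp add: abs_rep_L2)
qed

lemma rep_L2_measurable [measurable]: "rep_L2 f \<in> borel_measurable borel"
  using sq_integrable_rep[of f] by (simp add: sq_integrable_def)

lemma rep_L2_plus: "AE x in lborel. rep_L2 (f + g) x = rep_L2 f x + rep_L2 g x"
proof -
  have "abs_L2 (rep_L2 f) + abs_L2 (rep_L2 g) = abs_L2 (\<lambda>x. rep_L2 f x + rep_L2 g x)"
    by (rule plus_L2.abs_eq) (simp_all add: sq_integrable_rep)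
  then show ?thesis
    using rep_abs_L2[OF sq_integrable_add[OF sq_integrable_rep[of f] sq_integrable_rep[of g]]]
    by (simp add: abs_rep_L2)
qed

lemma rep_L2_cscale: "AE x in lborel. rep_L2 (c *\<^sub>C f) x = c * rep_L2 f x"
proof -
  have "c *\<^sub>C abs_L2 (rep_L2 f) = abs_L2 (\<lambda>x. c * rep_L2 f x)"
    by (rule cscale.abs_eq) (simp add: sq_integrable_rep)
  then show ?thesis
    using rep_abs_L2[OF sq_integrable_cmult[OF sq_integrable_rep[of f], of c]]
    by (simp add: abs_rep_L2)
qed

lemma rep_L2_cutoff: "AE x in lborel. rep_L2 (cutoff r f) x = indicator {-r<..<r} x * rep_L2 f x"
proof -
  have "cutoff r (abs_L2 (rep_L2 f)) = abs_L2 (\<lambda>x. indicator {-r<..<r} x * rep_L2 f x)"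
    by (rule cutoff.abs_eq) (simp add: sq_integrable_rep)
  then show ?thesis
    using rep_abs_L2[OF sq_integrable_indicator[OF sq_integrable_rep[of f], of "{-r<..<r}"]]
    by (simp add: abs_rep_L2)
qed

lemma minus_eq_cscale: "- f = (-1) *\<^sub>C (f :: L2)"
  by transfer (auto simp: sq_integrable_def)

lemma rep_L2_minus: "AE x in lborel. rep_L2 (f - g) x = rep_L2 f x - rep_L2 g x"
proof -
  have eq: "f - g = f + (-1) *\<^sub>C g"
    by (simp add: minus_L2_def minus_eq_cscale)
  show ?thesis
    unfolding eq using rep_L2_plus[of f "(-1) *\<^sub>C g"] rep_L2_cscale[of "-1" g]
    by eventually_elim simp
qed

lemma cinner_rep: "cinner f g = (\<integral>x. rep_L2 f x * cnj (rep_L2 g x) \<partial>lborel)"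
proof -
  have "cinner (abs_L2 (rep_L2 f)) (abs_L2 (rep_L2 g)) = (\<integral>x. rep_L2 f x * cnj (rep_L2 g x) \<partial>lborel)"
    by (rule cinner.abs_eq) (simp_all add: sq_integrable_rep)
  then show ?thesis by (simp add: abs_rep_L2)
qed

lemma cinner_add_left: "cinner (f + g) h = cinner f h + cinner g h"
  by transfer (simp add: distrib_right Bochner_Integration.integral_add sq_integrable_mult_cnj)

lemma cinner_scale_left: "cinner (c *\<^sub>C f) h = c * cinner f h"
  by transfer (simp add: mult.assoc)

lemma cinner_cnj: "cnj (cinner f g) = cinner g f"
proof transfer
  fix f g :: "real \<Rightarrow> complex"
  show "cnj (\<integral>x. f x * cnj (g x) \<partial>lborel) = (\<integral>x. g x * cnj (f x) \<partial>lborel)"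
    by (subst Bochner_Integration.integral_cnj[symmetric]) (simp add: mult.commute)
qed

lemma cinner_add_right: "cinner h (f + g) = cinner h f + cinner h g"
  by (metis cinner_add_left cinner_cnj complex_cnj_add)

lemma cinner_scale_right: "cinner h (c *\<^sub>C f) = cnj c * cinner h f"
  by (metis cinner_scale_left cinner_cnj complex_cnj_mult)

lemma cscale_cscale: "c *\<^sub>C d *\<^sub>C f = (c * d) *\<^sub>C (f :: L2)"
  by transfer (auto intro!: sq_integrable_cmult simp: mult.assoc)

lemma cscale_one [simp]: "1 *\<^sub>C f = f"
  by transfer auto

lemma cscale_zero_left [simp]: "0 *\<^sub>C f = 0"
  by transfer (auto simp: sq_integrable_zero)

lemma cscale_add_right: "c *\<^sub>C (f + g) = c *\<^sub>C f + c *\<^sub>C g"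
  by transfer (auto intro!: sq_integrable_add sq_integrable_cmult simp: distrib_left)

lemma cscale_add_left: "(c + d) *\<^sub>C f = c *\<^sub>C f + d *\<^sub>C f"
  by transfer (auto intro!: sq_integrable_add sq_integrable_cmult simp: distrib_right)

lemma cscale_minus_left: "(- c) *\<^sub>C f = - (c *\<^sub>C f)"
  by (simp add: minus_eq_cscale cscale_cscale)

lemma cscale_minus_right: "c *\<^sub>C (- f) = - (c *\<^sub>C f)"
  by (simp add: minus_eq_cscale cscale_cscale)

lemma cscale_diff_right: "c *\<^sub>C (f - g) = c *\<^sub>C f - c *\<^sub>C g"
  using cscale_add_right[of c f "- g"] by (simp add: cscale_minus_right)

lemma cscale_diff_left: "(c - d) *\<^sub>C f = c *\<^sub>C f - d *\<^sub>C f"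
  using cscale_add_left[of c "- d" f] by (simp add: cscale_minus_left)

lemma cscale_of_real: "complex_of_real r *\<^sub>C f = r *\<^sub>R f"
  by (simp add: scaleR_L2_def)

lemma cscale_zero_right [simp]: "c *\<^sub>C (0 :: L2) = 0"
  by transfer (auto simp: sq_integrable_zero)

lemma cscale_scaleR: "c *\<^sub>C (r *\<^sub>R f) = r *\<^sub>R (c *\<^sub>C f)"
  by (simp add: scaleR_L2_def cscale_cscale mult.commute)

lemma cinner_self: "cinner f f = complex_of_real ((norm f)\<^sup>2)"
proof -
  have "Im (cinner f f) = 0"
    using arg_cong[OF cinner_cnj[of f f], of Im] by simp
  moreover have "Re (cinner f f) = (norm f)\<^sup>2"
    by (simp add: power2_norm_eq_inner inner_L2_def)
  ultimately show ?thesis by (simp add: complex_eq_iff)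
qed

lemma norm_cscale: "norm (c *\<^sub>C f) = cmod c * norm (f :: L2)"
proof -
  have "complex_of_real ((norm (c *\<^sub>C f))\<^sup>2) = c * cnj c * cinner f f"
    unfolding cinner_self[symmetric] by (simp add: cinner_scale_left cinner_scale_right mult.assoc)
  also have "\<dots> = complex_of_real ((cmod c * norm f)\<^sup>2)"
    by (simp add: cinner_self complex_norm_square[symmetric] power_mult_distrib)
  finally have "(norm (c *\<^sub>C f))\<^sup>2 = (cmod c * norm f)\<^sup>2"
    using of_real_eq_iff by blast
  then show ?thesis by (simp add: power2_eq_iff_nonneg)
qed

text \<open>Rotating one argument makes the complex inner product real, which reduces the complex
  Cauchy-Schwarz inequality to the real one.\<close>

lemma cmod_cinner_le: "cmod (cinner f g) \<le> norm f * norm g"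
proof -
  define z where "z = cinner f g"
  have "cmod z * cmod z = inner (cnj z *\<^sub>C f) g"
    unfolding inner_L2_def cinner_scale_left z_def[symmetric]
    by (metis Re_complex_of_real complex_norm_square mult.commute power2_eq_square)
  also have "\<dots> \<le> norm (cnj z *\<^sub>C f) * norm g"
    by (rule norm_cauchy_schwarz)
  also have "\<dots> = cmod z * (norm f * norm g)"
    by (simp add: norm_cscale)
  finally show ?thesis
    by (cases "z = 0") (auto simp: z_def[symmetric])
qed

lemma bounded_bilinear_cinner: "bounded_bilinear cinner"
proof
  show "\<exists>B. \<forall>a b. norm (cinner a b) \<le> norm a * norm b * B"
    using cmod_cinner_le by (intro exI[of _ 1]) auto
qed (auto simp: cinner_add_left cinner_add_right scaleR_L2_def cinner_scale_left
      cinner_scale_right scaleR_conv_of_real)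

lemma cinner_zero [simp]: "cinner 0 f = 0" "cinner f 0 = 0"
  by (simp_all add: bounded_bilinear.zero_left[OF bounded_bilinear_cinner]
      bounded_bilinear.zero_right[OF bounded_bilinear_cinner])

lemma cinner_diff_left: "cinner (f - g) h = cinner f h - cinner g h"
  by (rule bounded_bilinear.diff_left[OF bounded_bilinear_cinner])

lemma cinner_diff_right: "cinner h (f - g) = cinner h f - cinner h g"
  by (rule bounded_bilinear.diff_right[OF bounded_bilinear_cinner])

lemma cinner_eqI: "(\<And>h. cinner h f = cinner h g) \<Longrightarrow> f = g"
  by (metis cinner_diff_right cinner_self eq_iff_diff_eq_0 norm_eq_zero of_real_eq_0_iff
      power_eq_0_iff)

lemma norm_square_integral: "(norm f)\<^sup>2 = (\<integral>x. (cmod (rep_L2 f x))\<^sup>2 \<partial>lborel)"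
proof -
  have "complex_of_real ((norm f)\<^sup>2) = (\<integral>x. complex_of_real ((cmod (rep_L2 f x))\<^sup>2) \<partial>lborel)"
    unfolding cinner_self[symmetric] cinner_rep by (simp only: complex_norm_square)
  then show ?thesis
    using of_real_eq_iff by (metis integral_complex_of_real)
qed

lemma norm_square_nn_integral:
  "ennreal ((norm f)\<^sup>2) = (\<integral>\<^sup>+x. ennreal ((cmod (rep_L2 f x))\<^sup>2) \<partial>lborel)"
  unfolding norm_square_integral
  using sq_integrable_rep[of f]
  by (intro nn_integral_eq_integral[symmetric]) (auto simp: sq_integrable_def)

lemma bounded_linear_cscale: "bounded_linear (\<lambda>f. c *\<^sub>C f)"
  by (rule bounded_linear_intro[where K = "cmod c"])
    (simp_all add: cscale_add_right cscale_scaleR norm_cscale mult.commute)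

text \<open>
  With \<open>u\<^sub>n\<close> the \<open>n\<close>-th difference, the sum of the \<open>\<bar>u\<^sub>n(x)\<bar>\<close> is dominated by the sum of
  \<open>2\<^sup>-\<^sup>n + 2\<^sup>n \<bar>u\<^sub>n(x)\<bar>\<^sup>2\<close>. The weighted squares have a finite total integral, so they are summable at
  almost every point.
\<close>

lemma fast_Cauchy_AE_convergent:
  fixes X :: "nat \<Rightarrow> L2"
  assumes fast: "\<And>n. norm (X (Suc n) - X n) \<le> (1/2) ^ n"
  shows "AE x in lborel. convergent (\<lambda>n. rep_L2 (X n) x)"
proof -
  define u where "u n x = rep_L2 (X (Suc n) - X n) x" for n x
  have [measurable]: "u n \<in> borel_measurable borel" for n
    unfolding u_def[abs_def] by simp
  have bound: "2 ^ n * (norm (X (Suc n) - X n))\<^sup>2 \<le> (1/2) ^ n" for n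
  proof -
    have "2 ^ n * (norm (X (Suc n) - X n))\<^sup>2 \<le> 2 ^ n * ((1/2) ^ n)\<^sup>2"
      by (intro mult_left_mono power_mono fast) auto
    also have "\<dots> = (1/2) ^ n"
      by (simp add: power2_eq_square power_one_over field_simps)
    finally show ?thesis .
  qed
  have "(\<integral>\<^sup>+x. (\<Sum>n. ennreal (2 ^ n * (cmod (u n x))\<^sup>2)) \<partial>lborel)
      = (\<Sum>n. \<integral>\<^sup>+x. ennreal (2 ^ n * (cmod (u n x))\<^sup>2) \<partial>lborel)"
    by (rule nn_integral_suminf) auto
  also have "\<dots> = (\<Sum>n. ennreal (2 ^ n * (norm (X (Suc n) - X n))\<^sup>2))"
    by (simp add: ennreal_mult nn_integral_cmult u_def norm_square_nn_integral)
  also have "\<dots> \<le> (\<Sum>n. ennreal ((1/2) ^ n))"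
    by (intro suminf_le ennreal_leI bound) auto
  also have "\<dots> < \<infinity>"
    by (subst suminf_ennreal2) (auto simp: summable_geometric)
  finally have "AE x in lborel. (\<Sum>n. ennreal (2 ^ n * (cmod (u n x))\<^sup>2)) \<noteq> \<infinity>"
    by (intro nn_integral_PInf_AE) auto
  moreover have "AE x in lborel. \<forall>n. u n x = rep_L2 (X (Suc n)) x - rep_L2 (X n) x"
    unfolding u_def AE_all_countable by (intro allI rep_L2_minus)
  ultimately show ?thesis
  proof eventually_elim
    case (elim x)
    have "summable (\<lambda>n. 2 ^ n * (cmod (u n x))\<^sup>2)"
      by (rule summable_suminf_not_top) (use elim in \<open>auto simp: top_ennreal_def[symmetric]\<close>)
    then have "summable (\<lambda>n. (1/2) ^ n + 2 ^ n * (cmod (u n x))\<^sup>2)"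
      by (intro summable_add summable_geometric) auto
    then have "summable (\<lambda>n. u n x)"
    proof (rule summable_comparison_test'[where N = 0])
      fix n
      define a where "a = (2::real) ^ n"
      have a: "a > 0" by (simp add: a_def)
      have "0 \<le> (a * cmod (u n x) - 1)\<^sup>2 + (a * cmod (u n x))\<^sup>2 + 1" by simp
      then have "2 * (a * cmod (u n x)) \<le> 2 * (1 + a\<^sup>2 * (cmod (u n x))\<^sup>2)"
        by (simp add: power2_eq_square algebra_simps)
      then have "cmod (u n x) \<le> 1 / a + a * (cmod (u n x))\<^sup>2"
        using a by (simp add: field_simps power2_eq_square)
      then show "norm (u n x) \<le> (1/2) ^ n + 2 ^ n * (cmod (u n x))\<^sup>2"
        by (simp add: a_def power_one_over)
    qed
    moreover have "(\<Sum>k<n. u k x) = rep_L2 (X n) x - rep_L2 (X 0) x" for n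
      using elim sum_lessThan_telescope[of "\<lambda>k. rep_L2 (X k) x" n] by simp
    ultimately have "convergent (\<lambda>n. rep_L2 (X n) x - rep_L2 (X 0) x)"
      by (simp add: summable_iff_convergent)
    from convergent_add[OF this convergent_const[of "rep_L2 (X 0) x"]] show ?case by simp
  qed
qed

text \<open>A Cauchy sequence has a rapidly convergent subsequence; the pointwise limit of the latter is its
  limit in norm by Fatou's lemma.\<close>

instance L2 :: complete_space
proof
  fix Y :: "nat \<Rightarrow> L2"
  assume "Cauchy Y"
  then have "\<forall>k. \<exists>N. \<forall>m\<ge>N. \<forall>n\<ge>N. norm (Y m - Y n) < (1/2) ^ k"
    by (auto simp: Cauchy_iff)
  then obtain N where N: "\<And>k m n. m \<ge> N k \<Longrightarrow> n \<ge> N k \<Longrightarrow> norm (Y m - Y n) < (1/2) ^ k"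
    by metis
  define r where "r = rec_nat (N 0) (\<lambda>k p. max (Suc p) (N (Suc k)))"
  have r_ge: "r k \<ge> N k" for k
    by (cases k) (auto simp: r_def)
  have r_Suc: "r (Suc k) > r k" for k
    by (auto simp: r_def)
  have r: "strict_mono r"
    by (rule strict_monoI_Suc) (rule r_Suc)
  define X where "X = Y \<circ> r"
  have "norm (X (Suc n) - X n) \<le> (1/2) ^ n" for n
    unfolding X_def comp_def using r_ge[of n] r_Suc[of n] by (intro less_imp_le[OF N]) auto
  then have conv: "AE x in lborel. convergent (\<lambda>n. rep_L2 (X n) x)"
    by (rule fast_Cauchy_AE_convergent)
  define f where "f x = lim (\<lambda>n. rep_L2 (X n) x)" for x
  have [measurable]: "f \<in> borel_measurable borel"
    unfolding f_def[abs_def] by (rule borel_measurable_lim_metric) simp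
  have Xm: "norm (X m - X n) \<le> (1/2) ^ k" if "m \<ge> k" "n \<ge> k" for m n k
    unfolding X_def comp_def
    using that r_ge[of k] monoD[OF strict_mono_mono[OF r]] by (intro less_imp_le[OF N]) (metis order_trans)+
  have fatou: "(\<integral>\<^sup>+x. ennreal ((cmod (rep_L2 (X n) x - f x))\<^sup>2) \<partial>lborel) \<le> ennreal (((1/2) ^ k)\<^sup>2)"
    if "n \<ge> k" for n k
  proof -
    have "(\<integral>\<^sup>+x. ennreal ((cmod (rep_L2 (X n) x - f x))\<^sup>2) \<partial>lborel)
        = (\<integral>\<^sup>+x. liminf (\<lambda>m. ennreal ((cmod (rep_L2 (X n) x - rep_L2 (X m) x))\<^sup>2)) \<partial>lborel)"
    proof (rule nn_integral_cong_AE, use conv in eventually_elim)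
      case (elim x)
      then have "(\<lambda>m. rep_L2 (X m) x) \<longlonglongrightarrow> f x"
        by (simp add: f_def convergent_LIMSEQ_iff)
      then have "(\<lambda>m. ennreal ((cmod (rep_L2 (X n) x - rep_L2 (X m) x))\<^sup>2))
          \<longlonglongrightarrow> ennreal ((cmod (rep_L2 (X n) x - f x))\<^sup>2)"
        by (intro tendsto_intros)
      from lim_imp_Liminf[OF sequentially_bot this] show ?case by (rule sym)
    qed
    also have "\<dots> \<le> liminf (\<lambda>m. \<integral>\<^sup>+x. ennreal ((cmod (rep_L2 (X n) x - rep_L2 (X m) x))\<^sup>2) \<partial>lborel)"
      by (rule nn_integral_liminf) simp
    also have "\<dots> = liminf (\<lambda>m. ennreal ((norm (X n - X m))\<^sup>2))"
    proof (intro arg_cong[where f = liminf] ext)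
      fix m
      show "(\<integral>\<^sup>+x. ennreal ((cmod (rep_L2 (X n) x - rep_L2 (X m) x))\<^sup>2) \<partial>lborel)
          = ennreal ((norm (X n - X m))\<^sup>2)"
        unfolding norm_square_nn_integral using rep_L2_minus[of "X n" "X m"]
        by (intro nn_integral_cong_AE) auto
    qed
    also have "\<dots> \<le> ennreal (((1/2) ^ k)\<^sup>2)"
      by (rule Liminf_le) (use that Xm[of k n] in \<open>auto simp: eventually_sequentially intro!: exI[of _ k] ennreal_leI power_mono\<close>)
    finally show ?thesis .
  qed
  have diff_sq: "sq_integrable (\<lambda>x. rep_L2 (X n) x - f x)" for n
    using fatou[of 0 n] unfolding sq_integrable_def
    by (auto intro!: integrableI_nonneg intro: le_less_trans)
  have f_sq: "sq_integrable f"
    using sq_integrable_add[OF sq_integrable_rep[of "X 0"] sq_integrable_cmult[OF diff_sq[of 0], of "-1"]]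
    by simp
  define F where "F = abs_L2 f"
  have close: "norm (X n - F) \<le> (1/2) ^ n" for n
  proof -
    have "ennreal ((norm (X n - F))\<^sup>2) = (\<integral>\<^sup>+x. ennreal ((cmod (rep_L2 (X n) x - f x))\<^sup>2) \<partial>lborel)"
      unfolding norm_square_nn_integral
      using rep_L2_minus[of "X n" F] rep_abs_L2[OF f_sq]
      by (intro nn_integral_cong_AE) (auto simp: F_def)
    with fatou[OF order_refl, of n]
    have "ennreal ((norm (X n - F))\<^sup>2) \<le> ennreal (((1/2) ^ n)\<^sup>2)" by (rule ord_eq_le_trans[rotated])
    then have "(norm (X n - F))\<^sup>2 \<le> ((1/2) ^ n)\<^sup>2"
      by (subst (asm) ennreal_le_iff) auto
    then show ?thesis by (rule power2_le_imp_le) simp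
  qed
  have "(\<lambda>n. X n - F) \<longlonglongrightarrow> 0"
    by (rule Lim_null_comparison[where g = "\<lambda>n. (1/2) ^ n"])
      (auto simp: close LIMSEQ_power_zero)
  then have "X \<longlonglongrightarrow> F" by (simp add: LIM_zero_iff)
  then have "Y \<longlonglongrightarrow> F"
    unfolding X_def using \<open>Cauchy Y\<close> r
    by (metis Cauchy_converges_subseq)
  then show "convergent Y" by (auto simp: convergent_def)
qed

section \<open>Resolvents of self-adjoint operators\<close>

text \<open>For a small step \<open>e\<close> the map \<open>f \<mapsto> f - e (A f - g)\<close> is a contraction, and its fixed point solves
  \<open>A f = g\<close>.\<close>

lemma coercive_surj:
  fixes A :: "'a :: {real_inner, complete_space} \<Rightarrow> 'a"
  assumes A: "bounded_linear A" and "d > 0"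
    and coercive: "\<And>f. d * (norm f)\<^sup>2 \<le> inner (A f) f"
  shows "\<exists>f. A f = g"
proof -
  interpret A: bounded_linear A by fact
  obtain M where M: "M > 0" "\<And>f. norm (A f) \<le> norm f * M"
    using A.pos_bounded by blast
  \<comment> \<open>This step satisfies both \<open>e M\<^sup>2 \<le> d\<close>, which makes the map contract, and \<open>e d \<le> 1\<close>, which
    makes the square root of \<open>1 - e d\<close> meaningful.\<close>
  define e where "e = d / (d\<^sup>2 + M\<^sup>2)"
  define q where "q = sqrt (1 - e * d)"
  have pos: "d\<^sup>2 + M\<^sup>2 > 0" using \<open>d > 0\<close> by (simp add: sum_power2_gt_zero_iff)
  have e: "e > 0" "e * M\<^sup>2 \<le> d" "e * d \<le> 1"
    using \<open>d > 0\<close> pos by (auto simp: e_def field_simps power2_eq_square)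
  have q: "0 \<le> q" "q < 1" "q\<^sup>2 = 1 - e * d"
    using e \<open>d > 0\<close> by (auto simp: q_def)
  have contr: "norm (f - e *\<^sub>R A f) \<le> q * norm f" for f
  proof (rule power2_le_imp_le)
    have "(norm (f - e *\<^sub>R A f))\<^sup>2 = (norm f)\<^sup>2 - 2 * e * inner (A f) f + e\<^sup>2 * (norm (A f))\<^sup>2"
      unfolding power2_norm_eq_inner
      by (simp add: inner_diff_left inner_diff_right inner_commute power2_eq_square algebra_simps)
    also have "\<dots> \<le> (norm f)\<^sup>2 - 2 * e * (d * (norm f)\<^sup>2) + e\<^sup>2 * (norm f * M)\<^sup>2"
      using e(1) by (intro add_mono diff_mono mult_left_mono power_mono coercive M) auto
    also have "\<dots> = (norm f)\<^sup>2 * (1 - 2 * e * d + e * (e * M\<^sup>2))"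
      by (simp add: power2_eq_square algebra_simps)
    also have "\<dots> \<le> (norm f)\<^sup>2 * (1 - 2 * e * d + e * d)"
      using e by (intro mult_left_mono add_left_mono) auto
    finally show "(norm (f - e *\<^sub>R A f))\<^sup>2 \<le> (q * norm f)\<^sup>2"
      by (simp add: q power_mult_distrib algebra_simps)
  qed (use q in auto)
  have "\<exists>!f. f - e *\<^sub>R (A f - g) = f"
  proof (rule banach_fix_type[OF q(1,2)], intro allI)
    fix x y
    have eq: "(x - e *\<^sub>R (A x - g)) - (y - e *\<^sub>R (A y - g)) = (x - y) - e *\<^sub>R A (x - y)"
      by (simp add: A.diff algebra_simps)
    show "dist (x - e *\<^sub>R (A x - g)) (y - e *\<^sub>R (A y - g)) \<le> q * dist x y"
      unfolding dist_norm eq by (rule contr)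
  qed
  then show ?thesis using e by auto
qed

definition selfadjoint :: "(L2 \<Rightarrow> L2) \<Rightarrow> bool" where
  "selfadjoint A \<longleftrightarrow> bounded_op A \<and> (\<forall>f g. cinner (A f) g = cinner f (A g))"

lemma bounded_op_comp: "bounded_op A \<Longrightarrow> bounded_op B \<Longrightarrow> bounded_op (A \<circ> B)"
  by (auto simp: bounded_op_def comp_def intro: bounded_linear_compose)

lemma bounded_op_add: "bounded_op A \<Longrightarrow> bounded_op B \<Longrightarrow> bounded_op (\<lambda>f. A f + B f)"
  by (auto simp: bounded_op_def cscale_add_right intro: bounded_linear_add)

lemma bounded_op_scale: "bounded_op A \<Longrightarrow> bounded_op (\<lambda>f. c *\<^sub>C A f)"
  by (auto simp: bounded_op_def cscale_cscale mult.commute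
      intro: bounded_linear_compose[OF bounded_linear_cscale])

context
  fixes S :: "L2 \<Rightarrow> L2" and z :: complex
  assumes S: "selfadjoint S" and z: "Im z \<noteq> 0"
begin

lemma fredholm_bounded_op: "bounded_op (fredholm S z)"
  using S unfolding selfadjoint_def bounded_op_def fredholm_def
  by (auto simp: cscale_diff_right cscale_cscale mult.commute
      intro!: bounded_linear_sub bounded_linear_ident bounded_linear_compose[OF bounded_linear_cscale])

text \<open>The quadratic form of \<open>S\<close> is real, so multiplication by \<open>cnj z\<close> isolates the
  imaginary part of \<open>z\<close>: \<open>Im (cnj z * \<langle>f - z S f, f\<rangle>) = - Im z * \<parallel>f\<parallel>\<^sup>2\<close>.\<close>

lemma fredholm_Im_form:
  "Re (cinner ((\<i> * cnj z) *\<^sub>C fredholm S z f) f) = Im z * (norm f)\<^sup>2"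
proof -
  have "cnj (cinner (S f) f) = cinner (S f) f"
    using S by (simp add: selfadjoint_def cinner_cnj)
  then have "Im (cinner (S f) f) = 0"
    by (metis Im_complex_of_real Reals_cases Reals_cnj_iff)
  then show ?thesis
    by (simp add: fredholm_def cinner_scale_left cinner_diff_left cinner_self algebra_simps)
qed

lemma fredholm_bounded_below: "\<bar>Im z\<bar> * norm f \<le> cmod z * norm (fredholm S z f)"
proof -
  have "\<bar>Im z\<bar> * (norm f)\<^sup>2 = \<bar>Re (cinner ((\<i> * cnj z) *\<^sub>C fredholm S z f) f)\<bar>"
    unfolding fredholm_Im_form by (simp add: abs_mult)
  also have "\<dots> \<le> norm ((\<i> * cnj z) *\<^sub>C fredholm S z f) * norm f"
    using cmod_cinner_le abs_Re_le_cmod order_trans by blast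
  finally have "(\<bar>Im z\<bar> * norm f) * norm f \<le> (cmod z * norm (fredholm S z f)) * norm f"
    by (simp add: norm_cscale norm_mult power2_eq_square mult.assoc)
  then show ?thesis
    by (cases "norm f = 0") auto
qed

lemma fredholm_bij: "bij (fredholm S z)"
proof (rule bijI)
  interpret F: bounded_linear "fredholm S z"
    using fredholm_bounded_op by (simp add: bounded_op_def)
  show "inj (fredholm S z)"
  proof (rule injI)
    fix f g assume "fredholm S z f = fredholm S z g"
    then have "\<bar>Im z\<bar> * norm (f - g) \<le> 0"
      using fredholm_bounded_below[of "f - g"] by (simp add: F.diff)
    then show "f = g" using z by (auto simp: mult_le_0_iff)
  qed
  show "surj (fredholm S z)"
  proof (rule surjI[where f = "\<lambda>g. SOME f. fredholm S z f = g"], rule someI_ex)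
    fix g
    \<comment> \<open>The rotation by \<open>c\<close> makes the Fredholm operator coercive, by the formula for its
      quadratic form.\<close>
    define c where "c = complex_of_real (sgn (Im z)) * (\<i> * cnj z)"
    have "c \<noteq> 0" using z by (auto simp: c_def sgn_eq_0_iff)
    have "\<exists>f. c *\<^sub>C fredholm S z f = c *\<^sub>C g"
    proof (rule coercive_surj[where d = "\<bar>Im z\<bar>"])
      show "bounded_linear (\<lambda>f. c *\<^sub>C fredholm S z f)"
        by (rule bounded_linear_compose[OF bounded_linear_cscale F.bounded_linear_axioms])
      fix f
      have "inner (c *\<^sub>C fredholm S z f) f
          = sgn (Im z) * Re (cinner ((\<i> * cnj z) *\<^sub>C fredholm S z f) f)"
        unfolding c_def inner_L2_def cscale_cscale[symmetric] cinner_scale_left[of "complex_of_real _"]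
        by simp
      then show "\<bar>Im z\<bar> * (norm f)\<^sup>2 \<le> inner (c *\<^sub>C fredholm S z f) f"
        by (simp add: fredholm_Im_form abs_sgn mult.assoc[symmetric] mult.commute)
    qed (use z in auto)
    then obtain f where "c *\<^sub>C fredholm S z f = c *\<^sub>C g" by auto
    then have "inverse c *\<^sub>C c *\<^sub>C fredholm S z f = inverse c *\<^sub>C c *\<^sub>C g" by simp
    then show "\<exists>f. fredholm S z f = g"
      using \<open>c \<noteq> 0\<close> by (auto simp: cscale_cscale)
  qed
qed

lemma fredholm_inv: "fredholm S z (inv (fredholm S z) f) = f"
  by (rule surj_f_inv_f[OF bij_is_surj[OF fredholm_bij]])

lemma inv_fredholm: "inv (fredholm S z) (fredholm S z f) = f"
  by (rule inv_f_f[OF bij_is_inj[OF fredholm_bij]])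

lemma inv_fredholm_norm_le: "\<bar>Im z\<bar> * norm (inv (fredholm S z) f) \<le> cmod z * norm f"
  using fredholm_bounded_below[of "inv (fredholm S z) f"] by (simp add: fredholm_inv)

lemma inv_fredholm_bounded_op: "bounded_op (inv (fredholm S z))"
proof -
  interpret F: bounded_linear "fredholm S z"
    using fredholm_bounded_op by (simp add: bounded_op_def)
  have inj: "f = g" if "fredholm S z f = fredholm S z g" for f g
    using that inv_fredholm by metis
  have scale: "fredholm S z (c *\<^sub>C f) = c *\<^sub>C fredholm S z f" for c f
    using fredholm_bounded_op by (simp add: bounded_op_def)
  show ?thesis
    unfolding bounded_op_def
  proof (intro conjI allI)
    show "bounded_linear (inv (fredholm S z))"
    proof (rule bounded_linear_intro[where K = "cmod z / \<bar>Im z\<bar>"])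
      show "norm (inv (fredholm S z) f) \<le> norm f * (cmod z / \<bar>Im z\<bar>)" for f
        using inv_fredholm_norm_le[of f] z by (simp add: field_simps)
    qed (rule inj, simp add: F.add F.scaleR fredholm_inv)+
    show "inv (fredholm S z) (c *\<^sub>C f) = c *\<^sub>C inv (fredholm S z) f" for c f
      by (rule inj) (simp add: scale fredholm_inv)
  qed
qed

end

lemma fredholm_adjoint:
  assumes "selfadjoint S"
  shows "cinner (fredholm S z f) g = cinner f (fredholm S (cnj z) g)"
  using assms by (simp add: selfadjoint_def fredholm_def cinner_diff_left cinner_diff_right
      cinner_scale_left cinner_scale_right)

lemma inv_fredholm_adjoint:
  assumes S: "selfadjoint S" and z: "Im z \<noteq> 0"
  shows "cinner (inv (fredholm S z) f) g = cinner f (inv (fredholm S (cnj z)) g)"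
proof -
  have z': "Im (cnj z) \<noteq> 0" using z by simp
  show ?thesis
    using fredholm_adjoint[OF S, of z "inv (fredholm S z) f" "inv (fredholm S (cnj z)) g"]
    by (simp add: fredholm_inv[OF S z] fredholm_inv[OF S z'])
qed

lemma inv_fredholm_expand:
  assumes S: "selfadjoint S" and z: "Im z \<noteq> 0"
  shows "inv (fredholm S z) f = f + z *\<^sub>C S (inv (fredholm S z) f)"
    and "inv (fredholm S z) f = f + z *\<^sub>C inv (fredholm S z) (S f)"
proof -
  show "inv (fredholm S z) f = f + z *\<^sub>C S (inv (fredholm S z) f)"
    using fredholm_inv[OF S z, of f] unfolding fredholm_def by (metis diff_add_cancel)
  have B: "bounded_op (inv (fredholm S z))" by (rule inv_fredholm_bounded_op[OF S z])
  interpret B: bounded_linear "inv (fredholm S z)" using B by (simp add: bounded_op_def)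
  have "f = inv (fredholm S z) f - z *\<^sub>C inv (fredholm S z) (S f)"
    using inv_fredholm[OF S z, of f] B
    by (simp add: fredholm_def[THEN fun_cong] B.diff bounded_op_def)
  then show "inv (fredholm S z) f = f + z *\<^sub>C inv (fredholm S z) (S f)"
    by (metis diff_add_cancel)
qed

text \<open>The norm of the resolvent grows like the reciprocal of the imaginary part, so the scaled
  resolvents remain bounded.\<close>

lemma scaled_resolvent_norm_le:
  assumes S: "selfadjoint S" and m: "m > 0"
  shows "norm ((\<i> * complex_of_real m) *\<^sub>C inv (fredholm S (Complex l (- m))) f) \<le> (\<bar>l\<bar> + m) * norm f"
proof -
  have "norm ((\<i> * complex_of_real m) *\<^sub>C inv (fredholm S (Complex l (- m))) f)
      \<le> cmod (Complex l (- m)) * norm f"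
    using inv_fredholm_norm_le[OF S, of "Complex l (- m)" f] m by (simp add: norm_cscale norm_mult)
  also have "\<dots> \<le> (\<bar>l\<bar> + m) * norm f"
    using cmod_le[of "Complex l (- m)"] m by (intro mult_right_mono) auto
  finally show ?thesis .
qed

lemma fredholm_shift:
  "fredholm S (Complex l (- m)) f = fredholm S (complex_of_real l) f + (\<i> * complex_of_real m) *\<^sub>C S f"
proof -
  have "Complex l (- m) = complex_of_real l - \<i> * complex_of_real m"
    by (simp add: complex_eq_iff)
  then show ?thesis
    by (simp add: fredholm_def cscale_diff_left)
qed

text \<open>Uniform boundedness makes the set of vectors on which a sequence of operators tends to zero
  closed.\<close>

lemma tendsto_zero_closure:
  fixes F :: "nat \<Rightarrow> 'a :: real_normed_vector \<Rightarrow> 'b :: real_normed_vector"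
  assumes lin: "\<And>n. linear (F n)" and bound: "\<And>n f. norm (F n f) \<le> C * norm f"
    and X: "X \<longlonglongrightarrow> g" "\<And>k :: nat. (\<lambda>n. F n (X k)) \<longlonglongrightarrow> 0"
  shows "(\<lambda>n. F n g) \<longlonglongrightarrow> 0"
proof (rule LIMSEQ_I)
  fix e :: real assume "e > 0"
  then have "e / (2 * (\<bar>C\<bar> + 1)) > 0" by simp
  then obtain k where k: "norm (X k - g) < e / (2 * (\<bar>C\<bar> + 1))"
    using LIMSEQ_D[OF X(1)] by blast
  obtain N where N: "\<And>n. n \<ge> N \<Longrightarrow> norm (F n (X k)) < e / 2"
    using LIMSEQ_D[OF X(2), of "e / 2" k] \<open>e > 0\<close> by auto
  have "norm (F n g - 0) < e" if "n \<ge> N" for n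
  proof -
    have "norm (F n g) = norm (F n (X k) - F n (X k - g))"
      by (simp add: linear_diff[OF lin])
    also have "\<dots> \<le> norm (F n (X k)) + norm (F n (X k - g))" by (rule norm_triangle_ineq4)
    also have "norm (F n (X k - g)) \<le> (\<bar>C\<bar> + 1) * norm (X k - g)"
      by (rule order_trans[OF bound]) (auto intro: mult_right_mono)
    also have "\<dots> \<le> e / 2" using k by (simp add: field_simps)
    finally show ?thesis using N[OF that] by simp
  qed
  then show "\<exists>N. \<forall>n\<ge>N. norm (F n g - 0) < e" by blast
qed

section \<open>Kernels and the operators they induce\<close>

text \<open>A nonempty open set is not a null set, so the set where two continuous functions agree is dense
  as soon as its complement is null, and it is closed.\<close>

lemma continuous_AE_eq:
  fixes f g :: "real \<Rightarrow> complex"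
  assumes "continuous_on UNIV f" "continuous_on UNIV g" and eq: "AE x in lborel. f x = g x"
  shows "f = g"
proof
  fix x
  have "closed {x. f x = g x}"
    using assms by (intro closed_Collect_eq)
  moreover have "AE x in lebesgue. x \<in> {x. f x = g x}"
    using eq by (intro AE_completion) simp
  ultimately show "f x = g x"
    using mem_closed_if_AE_lebesgue by blast
qed

lemma sq_integrable_cnj: "sq_integrable f \<Longrightarrow> sq_integrable (\<lambda>x. cnj (f x))"
  unfolding sq_integrable_def by (auto intro: borel_measurable_cnj)

lemma rep_L2_carleman:
  assumes "sq_integrable (K s)"
  shows "AE t in lborel. rep_L2 (carleman K s) t = cnj (K s t)"
  unfolding carleman_def using assms by (intro rep_abs_L2 sq_integrable_cnj)

lemma cinner_carleman:
  assumes "sq_integrable (K s)"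
  shows "cinner f (carleman K s) = (\<integral>t. K s t * rep_L2 f t \<partial>lborel)"
proof -
  have [measurable]: "K s \<in> borel_measurable borel"
    using assms by (simp add: sq_integrable_def)
  show ?thesis
    unfolding cinner_rep
    by (rule integral_cong_AE) (use rep_L2_carleman[of K s, OF assms] in \<open>auto simp: mult.commute\<close>)
qed

lemma K0_kernel_sq_integrable: "K0_kernel K \<Longrightarrow> sq_integrable (K s)"
  by (simp add: K0_kernel_def)

lemma induces_iff:
  assumes "K0_kernel K"
  shows "induces K A \<longleftrightarrow>
    bounded_op A \<and> (\<forall>f. AE s in lborel. rep_L2 (A f) s = cinner f (carleman K s))"
  unfolding induces_def cinner_carleman[OF K0_kernel_sq_integrable[OF assms]] ..

lemma carleman_continuous: "K0_kernel K \<Longrightarrow> continuous_on UNIV (carleman K)"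
  by (simp add: K0_kernel_def C0_def)

lemma continuous_cinner:
  "continuous_on UNIV f \<Longrightarrow> continuous_on UNIV g \<Longrightarrow> continuous_on UNIV (\<lambda>x. cinner (f x) (g x))"
  by (rule bounded_bilinear.continuous_on[OF bounded_bilinear_cinner])

text \<open>The function \<open>s \<mapsto> \<langle>f, k(s)\<rangle>\<close> is a canonical continuous representative of \<open>A f\<close>; this
  is what permits statements about kernels at every point rather than almost everywhere.\<close>

lemma induces_abs:
  assumes K: "K0_kernel K" and A: "induces K A"
  shows "sq_integrable (\<lambda>s. cinner f (carleman K s))"
    and "A f = abs_L2 (\<lambda>s. cinner f (carleman K s))"
proof -
  let ?g = "\<lambda>s. cinner f (carleman K s)"
  have [measurable]: "?g \<in> borel_measurable borel"
    by (intro borel_measurable_continuous_onI continuous_cinner continuous_on_const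
        carleman_continuous K)
  have ae: "AE s in lborel. rep_L2 (A f) s = ?g s"
    using A by (simp add: induces_iff[OF K])
  have "integrable lborel (\<lambda>x. (cmod (rep_L2 (A f) x))\<^sup>2)"
    using sq_integrable_rep[of "A f"] by (simp add: sq_integrable_def)
  also have "?this \<longleftrightarrow> integrable lborel (\<lambda>x. (cmod (?g x))\<^sup>2)"
    by (rule integrable_cong_AE) (use ae in auto)
  finally show sq: "sq_integrable ?g"
    by (simp add: sq_integrable_def)
  show "A f = abs_L2 ?g"
    by (rule L2_eqI) (use ae rep_abs_L2[OF sq] in auto)
qed

lemma induced_op_eq:
  assumes "induces K A"
  shows "induced_op K = A"
  unfolding induced_op_def
proof (rule the_equality)
  show "induces K A" by (rule assms)
next
  fix B assume B: "induces K B"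
  show "B = A"
  proof (rule ext, rule L2_eqI)
    fix f
    have "AE s in lborel. rep_L2 (B f) s = (\<integral>t. K s t * rep_L2 f t \<partial>lborel)"
      and "AE s in lborel. rep_L2 (A f) s = (\<integral>t. K s t * rep_L2 f t \<partial>lborel)"
      using B assms by (simp_all add: induces_def)
    then show "AE s in lborel. rep_L2 (B f) s = rep_L2 (A f) s" by auto
  qed
qed

text \<open>Both Carleman functions represent the same operator almost everywhere, hence everywhere by
  continuity; continuity of the kernels in the second variable does the rest.\<close>

lemma K0_kernel_unique:
  assumes K: "K0_kernel K" "induces K A" and L: "K0_kernel L" "induces L A"
  shows "K = L"
proof -
  have "carleman K s = carleman L s" for s
  proof (rule cinner_eqI)
    fix f
    have "(\<lambda>s. cinner f (carleman K s)) = (\<lambda>s. cinner f (carleman L s))"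
    proof (rule continuous_AE_eq)
      have "AE s in lborel. rep_L2 (A f) s = cinner f (carleman K s)"
        and "AE s in lborel. rep_L2 (A f) s = cinner f (carleman L s)"
        using K L by (auto simp: induces_iff)
      then show "AE s in lborel. cinner f (carleman K s) = cinner f (carleman L s)" by auto
    qed (intro continuous_cinner continuous_on_const carleman_continuous K L)+
    then show "cinner f (carleman K s) = cinner f (carleman L s)" by metis
  qed
  then have ae: "AE t in lborel. K s t = L s t" for s
    using rep_L2_carleman[of K s, OF K0_kernel_sq_integrable[OF K(1)]]
      rep_L2_carleman[of L s, OF K0_kernel_sq_integrable[OF L(1)]] by auto
  have cont: "continuous_on UNIV (M s)" if "K0_kernel M" for M s
  proof -
    have "continuous_on UNIV (\<lambda>t. case_prod M (s, t))"
      by (rule continuous_on_compose2[of UNIV "case_prod M"])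
        (use that in \<open>auto simp: K0_kernel_def C0_def intro!: continuous_intros\<close>)
    then show ?thesis by simp
  qed
  show "K = L"
    using continuous_AE_eq[OF cont[OF K(1)] cont[OF L(1)] ae] by blast
qed

lemma kernel_inducing_eq:
  assumes "K0_kernel K" "induces K A"
  shows "kernel_inducing A = K"
  unfolding kernel_inducing_def using assms K0_kernel_unique by (intro the_equality) auto

lemma C0_bounded:
  fixes f :: "'a :: {real_normed_vector, heine_borel} \<Rightarrow> 'b :: real_normed_vector"
  assumes "f \<in> C0"
  shows "bounded (range f)"
proof -
  have lim: "(f \<longlongrightarrow> 0) at_infinity" and cont: "continuous_on UNIV f"
    using assms by (auto simp: C0_def)
  obtain b where b: "\<And>x. norm x \<ge> b \<Longrightarrow> norm (f x) < 1"
    using tendstoD[OF lim, of 1] by (auto simp: eventually_at_infinity)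
  have "bounded (f ` cball 0 b)"
    by (intro compact_imp_bounded compact_continuous_image continuous_on_subset[OF cont]) auto
  moreover have "f ` (- cball 0 b) \<subseteq> ball 0 1"
    using b by (force simp: dist_norm)
  ultimately have "bounded (f ` cball 0 b \<union> f ` (- cball 0 b))"
    using bounded_subset[OF bounded_ball] by auto
  then show ?thesis
    by (simp add: image_Un[symmetric])
qed

lemma C0_linear:
  assumes "f \<in> C0" "bounded_linear A"
  shows "(\<lambda>x. A (f x)) \<in> C0"
  using assms linear_simps(3)
  by (auto simp: C0_def intro: bounded_linear.continuous_on bounded_linear.tendsto_zero)

lemma C0_add:
  assumes "f \<in> C0" "g \<in> C0"
  shows "(\<lambda>x. f x + g x) \<in> C0"
  using assms by (auto simp: C0_def intro: continuous_on_add tendsto_add_zero)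

text \<open>When the pair \<open>(s, t)\<close> is large, one of its entries is large, and the factor depending on the
  other entry is bounded.\<close>

lemma C0_cinner:
  fixes f g :: "real \<Rightarrow> L2"
  assumes f: "f \<in> C0" and g: "g \<in> C0"
  shows "(\<lambda>(s, t). cinner (f t) (g s)) \<in> C0"
proof -
  have cont: "continuous_on UNIV f" "continuous_on UNIV g"
    and lim: "(f \<longlongrightarrow> 0) at_infinity" "(g \<longlongrightarrow> 0) at_infinity"
    using f g by (auto simp: C0_def)
  obtain a where a: "a > 0" "\<And>x. norm (f x) \<le> a"
    using C0_bounded[OF f] by (auto simp: bounded_pos)
  obtain b where b: "b > 0" "\<And>x. norm (g x) \<le> b"
    using C0_bounded[OF g] by (auto simp: bounded_pos)
  have "continuous_on UNIV (\<lambda>p. cinner (f (snd p)) (g (fst p)))"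
    by (intro continuous_cinner continuous_on_compose2[OF cont(1)] continuous_on_compose2[OF cont(2)])
      (auto intro!: continuous_intros)
  moreover have "((\<lambda>p. cinner (f (snd p)) (g (fst p))) \<longlongrightarrow> 0) at_infinity"
  proof (rule tendstoI)
    fix e :: real assume e: "e > 0"
    obtain p where p: "\<And>x. norm x \<ge> p \<Longrightarrow> norm (f x) < e / b"
      using tendstoD[OF lim(1), of "e / b"] e b by (auto simp: eventually_at_infinity)
    obtain q where q: "\<And>x. norm x \<ge> q \<Longrightarrow> norm (g x) < e / a"
      using tendstoD[OF lim(2), of "e / a"] e a by (auto simp: eventually_at_infinity)
    have "norm (cinner (f t) (g s)) < e" if "norm (s, t) \<ge> \<bar>p\<bar> + \<bar>q\<bar>" for s t
    proof -
      have "norm t \<ge> p \<or> norm s \<ge> q"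
        using that norm_Pair_le[of s t] by auto
      then have "norm (f t) * norm (g s) < e"
      proof
        assume "norm t \<ge> p"
        have "norm (f t) * norm (g s) \<le> norm (f t) * b" by (intro mult_left_mono b) auto
        also have "\<dots> < e" using p[OF \<open>norm t \<ge> p\<close>] b by (simp add: field_simps)
        finally show ?thesis .
      next
        assume "norm s \<ge> q"
        have "norm (f t) * norm (g s) \<le> a * norm (g s)" by (intro mult_right_mono a) auto
        also have "\<dots> < e" using q[OF \<open>norm s \<ge> q\<close>] a by (simp add: field_simps)
        finally show ?thesis .
      qed
      with cmod_cinner_le[of "f t" "g s"] show ?thesis by simp
    qed
    then show "\<forall>\<^sub>F p in at_infinity. dist (cinner (f (snd p)) (g (fst p))) 0 < e"
      unfolding eventually_at_infinity by (intro exI[of _ "\<bar>p\<bar> + \<bar>q\<bar>"]) auto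
  qed
  ultimately show ?thesis
    by (simp add: C0_def case_prod_beta')
qed

lemma borel_measurable_C0:
  fixes f :: "real \<times> real \<Rightarrow> complex"
  shows "f \<in> C0 \<Longrightarrow> f \<in> borel_measurable borel"
  by (auto simp: C0_def intro: borel_measurable_continuous_onI)

lemma abs_L2_add_scale:
  assumes "sq_integrable f" "sq_integrable g"
  shows "abs_L2 (\<lambda>x. a * f x + b * g x) = a *\<^sub>C abs_L2 f + b *\<^sub>C abs_L2 g"
  using assms by (simp add: plus_L2.abs_eq cscale.abs_eq sq_integrable_cmult)

lemma K0_kernel_lincomb:
  fixes a b :: complex
  assumes K: "K0_kernel K" and L: "K0_kernel L"
  defines "M \<equiv> \<lambda>s t. a * K s t + b * L s t"
  shows "K0_kernel M"
    and "carleman M s = cnj a *\<^sub>C carleman K s + cnj b *\<^sub>C carleman L s"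
    and "induces K A \<Longrightarrow> induces L B \<Longrightarrow> induces M (\<lambda>f. a *\<^sub>C A f + b *\<^sub>C B f)"
proof -
  have sq: "sq_integrable (\<lambda>t. cnj (K s t))" "sq_integrable (\<lambda>t. cnj (L s t))"
    "sq_integrable (\<lambda>t. K t s)" "sq_integrable (\<lambda>t. L t s)"
    "sq_integrable (\<lambda>t. K s t)" "sq_integrable (\<lambda>t. L s t)" for s
    using K L by (auto simp: K0_kernel_def intro!: sq_integrable_cnj)
  have carl: "carleman M s = cnj a *\<^sub>C carleman K s + cnj b *\<^sub>C carleman L s" for s
    unfolding M_def carleman_def using abs_L2_add_scale[OF sq(1) sq(2), of "cnj a" s "cnj b" s] by simp
  show "carleman M s = cnj a *\<^sub>C carleman K s + cnj b *\<^sub>C carleman L s" by (rule carl)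
  have carl': "carleman' M s = a *\<^sub>C carleman' K s + b *\<^sub>C carleman' L s" for s
    unfolding M_def carleman'_def using abs_L2_add_scale[OF sq(3) sq(4), of a s b s] by simp
  have "(\<lambda>p. a * case_prod K p + b * case_prod L p) \<in> C0"
    using K L by (intro C0_add C0_linear[where A = "\<lambda>x. _ * x"] bounded_linear_mult_right)
      (auto simp: K0_kernel_def)
  then have C0M: "case_prod M \<in> C0"
    by (simp add: M_def case_prod_beta')
  have "carleman M \<in> C0" "carleman' M \<in> C0"
    unfolding carl[abs_def] carl'[abs_def]
    by (intro C0_add C0_linear[OF _ bounded_linear_cscale], use K L in \<open>simp_all add: K0_kernel_def\<close>)+
  with C0M show M: "K0_kernel M"
    unfolding K0_kernel_def M_def
    by (auto intro!: sq_integrable_add sq_integrable_cmult sq borel_measurable_C0)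
  show "induces M (\<lambda>f. a *\<^sub>C A f + b *\<^sub>C B f)" if A: "induces K A" and B: "induces L B"
    unfolding induces_iff[OF M]
  proof (intro conjI allI)
    show "bounded_op (\<lambda>f. a *\<^sub>C A f + b *\<^sub>C B f)"
      using A B by (intro bounded_op_add bounded_op_scale) (auto simp: induces_def)
    fix f
    have "AE s in lborel. rep_L2 (A f) s = cinner f (carleman K s)"
      and "AE s in lborel. rep_L2 (B f) s = cinner f (carleman L s)"
      using K L A B by (auto simp: induces_iff)
    then show "AE s in lborel. rep_L2 (a *\<^sub>C A f + b *\<^sub>C B f) s = cinner f (carleman M s)"
      using rep_L2_plus[of "a *\<^sub>C A f" "b *\<^sub>C B f"] rep_L2_cscale[of a "A f"] rep_L2_cscale[of b "B f"]
      by eventually_elim (simp add: carl cinner_add_right cinner_scale_right)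
  qed
qed

text \<open>Evaluating the left factor \<open>S\<close> at \<open>s\<close> pairs \<open>W S f\<close> with \<open>k(s)\<close>. Moving the operators to the
  other side of the pairing gives the Carleman function \<open>S W' k(s)\<close>, whose value at \<open>t\<close> is once more
  a pairing with \<open>k(t)\<close>. All resolvent and spectral kernels below arise in this way.\<close>

lemma sandwich_kernel:
  assumes K: "K0_kernel K" and S: "induces K S" "selfadjoint S"
    and W: "bounded_op W" "bounded_op W'" "\<And>f g. cinner (W f) g = cinner f (W' g)"
  defines "G \<equiv> \<lambda>s t. cinner (W (carleman K t)) (carleman K s)"
  shows "K0_kernel G" and "carleman G s = S (W' (carleman K s))" and "induces G (S \<circ> W \<circ> S)"
proof -
  let ?k = "carleman K"
  note abs = induces_abs[OF K S(1)]
  have G: "cnj (G s t) = cinner (W' (?k s)) (?k t)" for s t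
    unfolding G_def by (metis W(3) cinner_cnj)
  have carl: "carleman G s = S (W' (?k s))" for s
    unfolding carleman_def[of G] G by (rule abs(2)[symmetric])
  show "carleman G s = S (W' (?k s))" by (rule carl)
  have carl': "carleman' G t = S (W (?k t))" for t
    unfolding carleman'_def G_def by (rule abs(2)[symmetric])
  have k: "?k \<in> C0" using K by (simp add: K0_kernel_def)
  have lin: "bounded_linear W" "bounded_linear W'" "bounded_linear S"
    using W S by (auto simp: bounded_op_def induces_def)
  have C0G: "case_prod G \<in> C0"
    unfolding G_def by (rule C0_cinner[OF C0_linear[OF k lin(1)] k])
  have "sq_integrable (\<lambda>t. cnj (cnj (G s t)))" for s
    unfolding G by (intro sq_integrable_cnj abs(1))
  moreover have "sq_integrable (\<lambda>s. G s t)" for t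
    unfolding G_def by (rule abs(1))
  moreover have "carleman G \<in> C0" "carleman' G \<in> C0"
    unfolding carl[abs_def] carl'[abs_def]
    by (intro C0_linear[OF C0_linear[OF k]] lin)+
  ultimately show G0: "K0_kernel G"
    using C0G by (simp add: K0_kernel_def borel_measurable_C0)
  show "induces G (S \<circ> W \<circ> S)"
    unfolding induces_iff[OF G0]
  proof (intro conjI allI)
    show "bounded_op (S \<circ> W \<circ> S)"
      using S W by (intro bounded_op_comp) (auto simp: selfadjoint_def)
    fix f
    have "cinner (W (S f)) (?k s) = cinner f (carleman G s)" for s
      unfolding carl W(3) using S(2) by (simp add: selfadjoint_def)
    moreover have "AE s in lborel. rep_L2 (S (W (S f))) s = cinner (W (S f)) (?k s)"
      using S K by (simp add: induces_iff)
    ultimately show "AE s in lborel. rep_L2 ((S \<circ> W \<circ> S) f) s = cinner f (carleman G s)"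
      by simp
  qed
qed

text \<open>The identity \<open>S (I - z S)\<^sup>-\<^sup>1 = S + z S (I - z S)\<^sup>-\<^sup>1 S\<close> adds a sandwich to \<open>S\<close>. The parameter is
  conjugated in the Carleman function because Carleman functions carry a conjugation.\<close>

lemma resolvent_kernel_nonreal:
  assumes K: "K0_kernel K" and S: "induces K S" "selfadjoint S" and z: "Im z \<noteq> 0"
  shows "K0_kernel (resolvent_kernel K z)"
    and "carleman (resolvent_kernel K z) s = inv (fredholm S (cnj z)) (carleman K s)"
    and "resolvent_kernel K z s t
      = K s t + z * cinner (carleman K t) (carleman (resolvent_kernel K z) s)"
proof -
  let ?B = "inv (fredholm S z)" and ?B' = "inv (fredholm S (cnj z))"
  have z': "Im (cnj z) \<noteq> 0" using z by simp
  note adj = inv_fredholm_adjoint[OF S(2) z]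
  note B = inv_fredholm_bounded_op[OF S(2) z] inv_fredholm_bounded_op[OF S(2) z']
  define G where "G = (\<lambda>s t. cinner (?B (carleman K t)) (carleman K s))"
  note G = sandwich_kernel[OF K S B adj, folded G_def]
  define R where "R = (\<lambda>s t. 1 * K s t + z * G s t)"
  note R = K0_kernel_lincomb[OF K G(1), where a = 1 and b = z, folded R_def]
  have add: "S (f + g) = S f + S g" and scale: "S (c *\<^sub>C f) = c *\<^sub>C S f" for f g c
    using S(2) by (auto simp: selfadjoint_def bounded_op_def linear_simps)
  have "(\<lambda>f. 1 *\<^sub>C S f + z *\<^sub>C (S \<circ> ?B \<circ> S) f) = fredholm_resolvent S z"
  proof
    fix f
    have "S (?B f) = S (f + z *\<^sub>C ?B (S f))"
      by (subst inv_fredholm_expand(2)[OF S(2) z, of f]) (rule refl)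
    then show "1 *\<^sub>C S f + z *\<^sub>C (S \<circ> ?B \<circ> S) f = fredholm_resolvent S z f"
      by (simp add: fredholm_resolvent_def add scale)
  qed
  then have eq: "resolvent_kernel K z = R"
    unfolding resolvent_kernel_def induced_op_eq[OF S(1)]
    using R(3)[OF S(1) G(3)] by (intro kernel_inducing_eq R) simp
  show "K0_kernel (resolvent_kernel K z)" unfolding eq by (rule R(1))
  show carl: "carleman (resolvent_kernel K z) s = ?B' (carleman K s)" for s
    unfolding eq R(2) G(2) using inv_fredholm_expand(1)[OF S(2) z', of "carleman K s", symmetric] by simp
  show "resolvent_kernel K z s t = K s t + z * cinner (carleman K t) (carleman (resolvent_kernel K z) s)"
    unfolding carl unfolding eq R_def G_def by (simp add: adj)
qed

section \<open>Truncation\<close>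

lemma cutoff_bounded_op: "bounded_op (cutoff r)"
  and cutoff_selfadjoint: "cinner (cutoff r f) g = cinner f (cutoff r g)"
  and cutoff_idem: "cutoff r (cutoff r f) = cutoff r f"
  and norm_cutoff_le: "norm (cutoff r f) \<le> norm f"
proof -
  have scale: "cutoff r (c *\<^sub>C f) = c *\<^sub>C cutoff r f" for c f
  proof (rule L2_eqI)
    show "AE x in lborel. rep_L2 (cutoff r (c *\<^sub>C f)) x = rep_L2 (c *\<^sub>C cutoff r f) x"
      using rep_L2_cutoff[of r f] rep_L2_cutoff[of r "c *\<^sub>C f"] rep_L2_cscale[of c f]
        rep_L2_cscale[of c "cutoff r f"]
      by eventually_elim simp
  qed
  have add: "cutoff r (f + g) = cutoff r f + cutoff r g" for f g
  proof (rule L2_eqI)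
    show "AE x in lborel. rep_L2 (cutoff r (f + g)) x = rep_L2 (cutoff r f + cutoff r g) x"
      using rep_L2_cutoff[of r f] rep_L2_cutoff[of r g] rep_L2_cutoff[of r "f + g"]
        rep_L2_plus[of f g] rep_L2_plus[of "cutoff r f" "cutoff r g"]
      by eventually_elim (simp add: distrib_left)
  qed
  have le: "norm (cutoff r f) \<le> norm f" for f
  proof (rule power2_le_imp_le)
    have "ennreal ((norm (cutoff r f))\<^sup>2) \<le> ennreal ((norm f)\<^sup>2)"
      unfolding norm_square_nn_integral
      using rep_L2_cutoff[of r f]
      by (intro nn_integral_mono_AE) (auto elim!: eventually_mono simp: indicator_def)
    then show "(norm (cutoff r f))\<^sup>2 \<le> (norm f)\<^sup>2" by simp
  qed simp
  show "bounded_op (cutoff r)"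
    unfolding bounded_op_def
    by (intro conjI allI bounded_linear_intro[where K = 1])
      (auto simp: add scale le cscale_of_real[symmetric])
  show "cinner (cutoff r f) g = cinner f (cutoff r g)"
    unfolding cinner_rep
  proof (rule integral_cong_AE)
    show "AE x in lborel. rep_L2 (cutoff r f) x * cnj (rep_L2 g x)
        = rep_L2 f x * cnj (rep_L2 (cutoff r g) x)"
      using rep_L2_cutoff[of r f] rep_L2_cutoff[of r g]
      by eventually_elim (simp add: indicator_def)
  qed simp_all
  show "cutoff r (cutoff r f) = cutoff r f"
  proof (rule L2_eqI)
    show "AE x in lborel. rep_L2 (cutoff r (cutoff r f)) x = rep_L2 (cutoff r f) x"
      using rep_L2_cutoff[of r f] rep_L2_cutoff[of r "cutoff r f"]
      by eventually_elim (simp add: indicator_def)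
  qed
  show "norm (cutoff r f) \<le> norm f" by (rule le)
qed

lemma norm_cutoff_complement_square:
  "ennreal ((norm (f - cutoff r f))\<^sup>2)
    = (\<integral>\<^sup>+x\<in>- {-r<..<r}. ennreal ((cmod (rep_L2 f x))\<^sup>2) \<partial>lborel)"
  unfolding norm_square_nn_integral
proof (rule nn_integral_cong_AE)
  show "AE x in lborel. ennreal ((cmod (rep_L2 (f - cutoff r f) x))\<^sup>2)
      = ennreal ((cmod (rep_L2 f x))\<^sup>2) * indicator (- {-r<..<r}) x"
    using rep_L2_minus[of f "cutoff r f"] rep_L2_cutoff[of r f]
    by eventually_elim (simp add: indicator_def)
qed

lemma norm_cutoff_complement_le: "norm (f - cutoff r f) \<le> norm f"
proof (rule power2_le_imp_le)
  have "ennreal ((norm (f - cutoff r f))\<^sup>2) \<le> ennreal ((norm f)\<^sup>2)"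
    unfolding norm_cutoff_complement_square unfolding norm_square_nn_integral
    by (intro nn_integral_mono) (simp add: indicator_def)
  then show "(norm (f - cutoff r f))\<^sup>2 \<le> (norm f)\<^sup>2" by simp
qed simp

lemma cutoff_tendsto:
  assumes r: "filterlim r at_top sequentially"
  shows "(\<lambda>n. f - cutoff (r n) f) \<longlonglongrightarrow> 0"
proof -
  have "(\<lambda>n. \<integral>x. (cmod (rep_L2 (f - cutoff (r n) f) x))\<^sup>2 \<partial>lborel) \<longlonglongrightarrow> integral\<^sup>L lborel (\<lambda>_ :: real. 0)"
  proof (rule integral_dominated_convergence[where w = "\<lambda>x. (cmod (rep_L2 f x))\<^sup>2"])
    show "integrable lborel (\<lambda>x. (cmod (rep_L2 f x))\<^sup>2)"
      using sq_integrable_rep[of f] by (simp add: sq_integrable_def)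
    have ae: "AE x in lborel. rep_L2 (f - cutoff (r n) f) x = indicator (- {-r n<..<r n}) x * rep_L2 f x"
      for n
      using rep_L2_minus[of f "cutoff (r n) f"] rep_L2_cutoff[of "r n" f]
      by eventually_elim (simp add: indicator_def)
    show "AE x in lborel. norm ((cmod (rep_L2 (f - cutoff (r n) f) x))\<^sup>2) \<le> (cmod (rep_L2 f x))\<^sup>2" for n
      using ae[of n] by eventually_elim (simp add: indicator_def)
    have "AE x in lborel. \<forall>n. rep_L2 (f - cutoff (r n) f) x = indicator (- {-r n<..<r n}) x * rep_L2 f x"
      unfolding AE_all_countable using ae by blast
    then show "AE x in lborel. (\<lambda>n. (cmod (rep_L2 (f - cutoff (r n) f) x))\<^sup>2) \<longlonglongrightarrow> 0"
    proof eventually_elim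
      case (elim x)
      have "\<forall>\<^sub>F n in sequentially. \<bar>x\<bar> < r n"
        using r by (auto simp: filterlim_at_top_dense)
      then have "\<forall>\<^sub>F n in sequentially. (cmod (rep_L2 (f - cutoff (r n) f) x))\<^sup>2 = 0"
        by eventually_elim (auto simp: elim indicator_def)
      then show ?case by (rule tendsto_eventually)
    qed
  qed simp_all
  then have "(\<lambda>n. (norm (f - cutoff (r n) f))\<^sup>2) \<longlonglongrightarrow> 0"
    by (simp add: norm_square_integral)
  then have "(\<lambda>n. sqrt ((norm (f - cutoff (r n) f))\<^sup>2)) \<longlonglongrightarrow> sqrt 0"
    by (intro tendsto_real_sqrt)
  then show ?thesis by (simp add: tendsto_norm_zero_iff)
qed

lemma square_cut_induces:
  assumes K: "K0_kernel K" and T: "induces K T"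
  shows "induces (square_cut r K) (cutoff r \<circ> T \<circ> cutoff r)"
  unfolding induces_def
proof (intro conjI allI)
  show "bounded_op (cutoff r \<circ> T \<circ> cutoff r)"
    using T by (intro bounded_op_comp cutoff_bounded_op) (simp add: induces_def)
  fix f
  have int: "(\<integral>t. square_cut r K s t * rep_L2 f t \<partial>lborel)
      = indicator {-r<..<r} s * (\<integral>t. K s t * rep_L2 (cutoff r f) t \<partial>lborel)" for s
  proof -
    have [measurable]: "K s \<in> borel_measurable borel"
      using K0_kernel_sq_integrable[OF K, of s] by (simp add: sq_integrable_def)
    have "(\<integral>t. K s t * rep_L2 (cutoff r f) t \<partial>lborel)
        = (\<integral>t. K s t * (indicator {-r<..<r} t * rep_L2 f t) \<partial>lborel)"
      by (rule integral_cong_AE) (use rep_L2_cutoff[of r f] in auto)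
    then show ?thesis
      by (simp add: square_cut_def mult.assoc)
  qed
  have "AE s in lborel. rep_L2 (T (cutoff r f)) s = (\<integral>t. K s t * rep_L2 (cutoff r f) t \<partial>lborel)"
    using T by (simp add: induces_def)
  then show "AE s in lborel. rep_L2 ((cutoff r \<circ> T \<circ> cutoff r) f) s
      = (\<integral>t. square_cut r K s t * rep_L2 f t \<partial>lborel)"
    using rep_L2_cutoff[of r "T (cutoff r f)"]
    by eventually_elim (simp add: int)
qed

lemma carleman_square_cut:
  assumes K: "K0_kernel K"
  shows "carleman (square_cut r K) s = indicator {-r<..<r} s *\<^sub>R cutoff r (carleman K s)"
proof -
  have sq: "sq_integrable (\<lambda>t. cnj (K s t))"
    by (intro sq_integrable_cnj K0_kernel_sq_integrable K)
  have "carleman (square_cut r K) s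
      = abs_L2 (\<lambda>t. indicator {-r<..<r} s * (indicator {-r<..<r} t * cnj (K s t)))"
    unfolding carleman_def square_cut_def
    by (intro arg_cong[where f = abs_L2] ext) (simp add: indicator_def)
  also have "\<dots> = indicator {-r<..<r} s *\<^sub>C cutoff r (carleman K s)"
    unfolding carleman_def
    using sq by (simp add: cscale.abs_eq cutoff.abs_eq sq_integrable_indicator)
  finally show ?thesis by (simp add: indicator_def)
qed

section \<open>Spectral measures\<close>

context
  fixes T :: "L2 \<Rightarrow> L2" and E :: "real set \<Rightarrow> L2 \<Rightarrow> L2"
  assumes E: "resolution_of_identity T E" and T: "bounded_op T"
begin

lemma spectral_projection:
  assumes "\<omega> \<in> sets borel"
  shows "bounded_op (E \<omega>)" and "cinner (E \<omega> f) g = cinner f (E \<omega> g)"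
  using E assms by (auto simp: resolution_of_identity_def orthogonal_projection_def)

lemma spectral_inter:
  assumes "\<omega> \<in> sets borel" "\<omega>' \<in> sets borel"
  shows "E \<omega> (E \<omega>' f) = E (\<omega> \<inter> \<omega>') f"
  using E assms by (simp add: resolution_of_identity_def)

lemma spectral_empty: "E {} f = 0" and spectral_UNIV: "E UNIV f = f"
  using E by (simp_all add: resolution_of_identity_def)

lemma spectral_sums:
  assumes "range W \<subseteq> sets borel" "disjoint_family W"
  shows "(\<lambda>n :: nat. E (W n) f) sums E (\<Union>n. W n) f"
  using E assms by (simp add: resolution_of_identity_def)

lemma spectral_union:
  assumes A: "A \<in> sets borel" and B: "B \<in> sets borel" and "A \<inter> B = {}"
  shows "E (A \<union> B) f = E A f + E B f"
proof -
  have "(\<lambda>n. E (binaryset A B n) f) sums E (\<Union>n. binaryset A B n) f"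
    using assms by (intro spectral_sums) (auto simp: disjoint_family_on_def binaryset_def)
  moreover have "(\<lambda>n. E (binaryset A B n) f) sums (\<Sum>n\<in>{0, 1}. E (binaryset A B n) f)"
    by (rule sums_finite) (auto simp: binaryset_def spectral_empty)
  ultimately show ?thesis
    by (simp add: UN_binaryset_eq binaryset_def sums_unique2)
qed

lemma spectral_compl:
  assumes "\<omega> \<in> sets borel"
  shows "f = E \<omega> f + E (- \<omega>) f"
  using spectral_union[of \<omega> "- \<omega>" f] assms by (simp add: spectral_UNIV borel_comp)

lemma norm_spectral_square:
  assumes "\<omega> \<in> sets borel"
  shows "cinner (E \<omega> f) f = complex_of_real ((norm (E \<omega> f))\<^sup>2)"
  using spectral_projection(2)[OF assms, of "E \<omega> f" f] spectral_inter[OF assms assms, of f]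
  by (simp add: cinner_self)

lemma sets_spectral_distribution [measurable_cong, simp]:
  "sets (spectral_distribution E f) = sets borel"
  and space_spectral_distribution [simp]: "space (spectral_distribution E f) = UNIV"
  unfolding spectral_distribution_def
  by (simp_all add: sets.sigma_sets_eq[of borel, unfolded space_borel])

lemma emeasure_spectral_distribution:
  assumes \<omega>: "\<omega> \<in> sets borel"
  shows "emeasure (spectral_distribution E f) \<omega> = ennreal ((norm (E \<omega> f))\<^sup>2)"
proof -
  let ?\<mu> = "\<lambda>\<omega>. ennreal (Re (cinner (E \<omega> f) f))"
  have "sigma_algebra UNIV (sets (borel :: real measure))"
    using sets.sigma_algebra_axioms[of "borel :: real measure"] by simp
  moreover have "positive (sets borel) ?\<mu>"
    by (simp add: positive_def spectral_empty)
  moreover have "countably_additive (sets borel) ?\<mu>"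
    unfolding countably_additive_def
  proof (intro allI impI)
    fix W :: "nat \<Rightarrow> real set"
    assume W: "range W \<subseteq> sets borel" "disjoint_family W"
    have nonneg: "0 \<le> Re (cinner (E (W n) f) f)" for n
      using W by (subst norm_spectral_square) auto
    have "(\<lambda>n. Re (cinner (E (W n) f) f)) sums Re (cinner (E (\<Union>n. W n) f) f)"
      using bounded_linear.sums[OF bounded_linear_compose[OF bounded_linear_Re
            bounded_bilinear.bounded_linear_left[OF bounded_bilinear_cinner]] spectral_sums[OF W]] .
    then show "(\<Sum>n. ?\<mu> (W n)) = ?\<mu> (\<Union>n. W n)"
      by (intro suminf_ennreal_eq) (simp_all add: nonneg)
  qed
  ultimately have "emeasure (spectral_distribution E f) \<omega> = ?\<mu> \<omega>"
    unfolding spectral_distribution_def using \<omega>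
    by (intro emeasure_measure_of_sigma) auto
  then show ?thesis by (simp add: norm_spectral_square[OF \<omega>])
qed

lemma spectral_form:
  "integrable (spectral_distribution E f) (\<lambda>x. x)"
  "cinner (T f) f = complex_of_real (\<integral>x. x \<partial>spectral_distribution E f)"
  using E by (simp_all add: resolution_of_identity_def)

text \<open>A bounded operator on a complex Hilbert space whose quadratic form is real is
  self-adjoint, by polarization.\<close>

lemma selfadjoint_of_spectral: "selfadjoint T"
  unfolding selfadjoint_def
proof (intro conjI allI T)
  fix f g
  have add: "T (f + g) = T f + T g" and scale: "T (c *\<^sub>C f) = c *\<^sub>C T f" for c f g
    using T by (auto simp: bounded_op_def linear_simps)
  have re: "Im (cinner (T f) f) = 0" for f by (simp add: spectral_form(2))
  have "Im (cinner (T f) g) + Im (cinner (T g) f) = 0"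
    using re[of "f + g"] by (simp add: add cinner_add_left cinner_add_right re)
  moreover have "Re (cinner (T f) g) - Re (cinner (T g) f) = 0"
    using re[of "\<i> *\<^sub>C f + g"]
    by (simp add: add scale cinner_add_left cinner_add_right cinner_scale_left cinner_scale_right re)
  ultimately have "cinner (T f) g = cnj (cinner (T g) f)"
    by (simp add: complex_eq_iff)
  then show "cinner (T f) g = cinner f (T g)" by (simp add: cinner_cnj)
qed

lemma T_simps:
  "T (f + g) = T f + T g" "T (f - g) = T f - T g" "T (c *\<^sub>C f) = c *\<^sub>C T f" "T (r *\<^sub>R f) = r *\<^sub>R T f"
  "cinner (T f) g = cinner f (T g)"
  using T selfadjoint_of_spectral by (auto simp: bounded_op_def linear_simps selfadjoint_def)

text \<open>Spectral measures of projected vectors are restrictions of the original one; this is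
  multiplicativity of \<open>E\<close>.\<close>

lemma spectral_distribution_restrict:
  assumes \<omega>: "\<omega> \<in> sets borel"
  shows "spectral_distribution E (E \<omega> f) = density (spectral_distribution E f) (\<lambda>x. indicator \<omega> x :: real)"
proof (rule measure_eqI)
  fix A assume "A \<in> sets (spectral_distribution E (E \<omega> f))"
  then have A: "A \<in> sets borel" by simp
  have ind: "ennreal (indicator \<omega> x) * indicator A x = indicator (A \<inter> \<omega>) x" for x :: real
    by (auto simp: indicator_def)
  show "emeasure (spectral_distribution E (E \<omega> f)) A
      = emeasure (density (spectral_distribution E f) (\<lambda>x. indicator \<omega> x :: real)) A"
    using A \<omega> by (simp add: emeasure_density ind emeasure_spectral_distribution spectral_inter)
qed simp

lemma spectral_form_restrict:
  assumes \<omega>: "\<omega> \<in> sets borel"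
  shows "cinner (T (E \<omega> f)) (E \<omega> f)
    = complex_of_real (\<integral>x. indicator \<omega> x * x \<partial>spectral_distribution E f)"
  unfolding spectral_form(2) spectral_distribution_restrict[OF \<omega>]
  using \<omega> by (subst integral_density) auto

text \<open>The quadratic form of \<open>T\<close> splits along \<open>\<omega>\<close> and its complement, so the cross terms
  \<open>\<langle>T f, g\<rangle>\<close> with \<open>f\<close> in the range of \<open>E \<omega>\<close> and \<open>g\<close> in that of \<open>E (- \<omega>)\<close> vanish: both
  ranges are invariant under \<open>T\<close>.\<close>

lemma spectral_commute:
  assumes \<omega>: "\<omega> \<in> sets borel"
  shows "T (E \<omega> f) = E \<omega> (T f)"
proof -
  note \<omega>' = borel_comp[OF \<omega>]
  have re: "Re (cinner (T (E \<omega> f)) (E (- \<omega>) g)) = 0" for f g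
  proof -
    define h where "h = E \<omega> f + E (- \<omega>) g"
    have h: "E \<omega> h = E \<omega> f" "E (- \<omega>) h = E (- \<omega>) g"
      using spectral_projection(1)[OF \<omega>] spectral_projection(1)[OF \<omega>'] \<omega> \<omega>'
      by (auto simp: h_def bounded_op_def linear_simps spectral_inter spectral_empty)
    have int: "integrable (spectral_distribution E h) (\<lambda>x. indicator A x * x)" if "A \<in> sets borel" for A
      using integrable_mult_indicator[OF _ spectral_form(1)[of h], of A] that by simp
    have "cinner (T h) h = complex_of_real (\<integral>x. indicator \<omega> x * x + indicator (- \<omega>) x * x
        \<partial>spectral_distribution E h)"
      unfolding spectral_form(2)
      by (intro arg_cong[where f = complex_of_real] Bochner_Integration.integral_cong)
        (auto simp: indicator_def)
    also have "\<dots> = cinner (T (E \<omega> h)) (E \<omega> h) + cinner (T (E (- \<omega>) h)) (E (- \<omega>) h)"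
      unfolding spectral_form_restrict[OF \<omega>] spectral_form_restrict[OF \<omega>']
      by (subst Bochner_Integration.integral_add[OF int[OF \<omega>] int[OF \<omega>']]) simp
    finally have "cinner (T (E \<omega> f)) (E (- \<omega>) g) + cinner (T (E (- \<omega>) g)) (E \<omega> f) = 0"
      unfolding h by (simp add: h_def T_simps(1) cinner_add_left cinner_add_right add.commute)
    moreover have "cinner (T (E (- \<omega>) g)) (E \<omega> f) = cnj (cinner (T (E \<omega> f)) (E (- \<omega>) g))"
      by (simp add: T_simps(5) cinner_cnj)
    ultimately show ?thesis
      by (simp add: complex_eq_iff)
  qed
  have zero: "cinner (T (E \<omega> f)) (E (- \<omega>) g) = 0" for f g
  proof -
    have "cinner (T (E \<omega> (\<i> *\<^sub>C f))) (E (- \<omega>) g) = \<i> * cinner (T (E \<omega> f)) (E (- \<omega>) g)"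
      using spectral_projection(1)[OF \<omega>] by (simp add: bounded_op_def T_simps cinner_scale_left)
    then have "Im (cinner (T (E \<omega> f)) (E (- \<omega>) g)) = 0"
      using re[of "\<i> *\<^sub>C f" g] by simp
    then show ?thesis using re[of f g] by (simp add: complex_eq_iff)
  qed
  have 1: "E (- \<omega>) (T (E \<omega> f)) = 0"
    using zero[of f] spectral_projection(2)[OF \<omega>', symmetric]
    by (intro cinner_eqI) (metis cinner_cnj cinner_zero(2) complex_cnj_zero)
  have "E \<omega> (T (E (- \<omega>) f)) = 0"
  proof (rule cinner_eqI)
    fix g
    have "cinner g (E \<omega> (T (E (- \<omega>) f))) = cinner (T (E \<omega> g)) (E (- \<omega>) f)"
      by (simp add: spectral_projection(2)[OF \<omega>, symmetric] T_simps(5))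
    then show "cinner g (E \<omega> (T (E (- \<omega>) f))) = cinner g 0" by (simp add: zero)
  qed
  then have "E \<omega> (T f) = E \<omega> (T (E \<omega> f))"
    using arg_cong[OF spectral_compl[OF \<omega>, of f], of "\<lambda>f. E \<omega> (T f)"] spectral_projection(1)[OF \<omega>]
    by (simp add: T_simps bounded_op_def linear_simps)
  then show ?thesis
    using spectral_compl[OF \<omega>, of "T (E \<omega> f)"] 1 by simp
qed

text \<open>The spectral measure of \<open>g\<close> is concentrated on \<open>\<omega>\<close>, so the inequality can be integrated. The
  sign \<open>\<sigma>\<close> lets the same estimate serve on either side of \<open>x0\<close>.\<close>

lemma spectral_form_ge:
  assumes \<omega>: "\<omega> \<in> sets borel" and ge: "\<And>x. x \<in> \<omega> \<Longrightarrow> e \<le> \<sigma> * (x - x0)" and g: "E \<omega> g = g"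
  shows "e * (norm g)\<^sup>2 \<le> \<sigma> * inner (T g - x0 *\<^sub>R g) g"
proof -
  let ?M = "spectral_distribution E g"
  have total: "emeasure ?M UNIV = ennreal ((norm g)\<^sup>2)"
    by (simp add: emeasure_spectral_distribution spectral_UNIV)
  interpret finite_measure ?M
    by (rule finite_measureI) (simp add: total)
  have one: "measure ?M UNIV = (norm g)\<^sup>2"
    using total by (simp add: measure_def)
  have "emeasure ?M (- \<omega>) = 0"
    using \<omega> spectral_inter[OF borel_comp[OF \<omega>] \<omega>, of g]
    by (simp add: emeasure_spectral_distribution borel_comp g spectral_empty)
  then have ae: "AE x in ?M. x \<in> \<omega>"
    using \<omega> by (intro AE_I[of _ _ "- \<omega>"]) (auto simp: borel_comp)
  have "e * (norm g)\<^sup>2 = (\<integral>x. e \<partial>?M)" by (simp add: one)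
  also have "\<dots> \<le> (\<integral>x. \<sigma> * (x - x0) \<partial>?M)"
    by (rule integral_mono_AE) (use ae ge spectral_form(1) in \<open>auto elim!: eventually_mono\<close>)
  also have "\<dots> = \<sigma> * ((\<integral>x. x \<partial>?M) - x0 * (norm g)\<^sup>2)"
    using spectral_form(1)[of g] by (simp add: one)
  also have "\<dots> = \<sigma> * inner (T g - x0 *\<^sub>R g) g"
    using spectral_form(2)[of g] by (simp add: inner_L2_def[of "T g"] inner_diff_left power2_norm_eq_inner)
  finally show ?thesis .
qed

text \<open>On the range of \<open>E {x0}\<close> the symmetric operator \<open>T - x0\<close> has vanishing quadratic
  form, hence vanishes.\<close>

lemma spectral_eigenvector: "T (E {x0} f) = x0 *\<^sub>R E {x0} f"
proof -
  have x0: "{x0} \<in> sets borel" by simp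
  define A where "A h = T h - x0 *\<^sub>R h" for h
  have A: "A (h + h') = A h + A h'" "inner (A h) h' = inner h (A h')" for h h'
    by (simp_all add: A_def T_simps(1) algebra_simps inner_diff_left inner_diff_right
        inner_L2_def[of "T _"] inner_L2_def[of _ "T _"] T_simps(5))
  have form: "inner (A h) h = 0" if "E {x0} h = h" for h
    using spectral_form_ge[OF x0 _ that, of 0 1 x0] spectral_form_ge[OF x0 _ that, of 0 "-1" x0]
    by (simp add: A_def)
  define g where "g = E {x0} f"
  have lin: "bounded_linear (E {x0})"
    using spectral_projection(1)[OF x0] by (simp add: bounded_op_def)
  have g: "E {x0} g = g" by (simp add: g_def spectral_inter)
  have Ag: "E {x0} (A g) = A g"
    using spectral_commute[OF x0, of g] lin by (simp add: A_def linear_simps g)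
  have sum: "E {x0} (g + A g) = g + A g" using lin g Ag by (simp add: linear_simps)
  have "inner (A (g + A g)) (g + A g) = 2 * inner (A g) (A g)"
    using form[OF g] form[OF Ag] A(2)[of "A g" g]
    by (simp add: A(1) inner_add_left inner_add_right)
  then have "A g = 0" using form[OF sum] by simp
  then show ?thesis by (simp add: A_def g_def)
qed

lemma spectral_inv_fredholm:
  assumes \<omega>: "\<omega> \<in> sets borel" and z: "Im z \<noteq> 0" and g: "E \<omega> g = g"
  shows "E \<omega> (inv (fredholm T z) g) = inv (fredholm T z) g"
proof -
  note S = selfadjoint_of_spectral
  let ?h = "inv (fredholm T z) g"
  have "fredholm T z (E \<omega> ?h) = E \<omega> (fredholm T z ?h)"
    using spectral_projection(1)[OF \<omega>]
    by (simp add: fredholm_def spectral_commute[OF \<omega>] bounded_op_def linear_simps)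
  also have "\<dots> = g" by (simp add: fredholm_inv[OF S z] g)
  finally show ?thesis by (metis inv_fredholm[OF S z])
qed

section \<open>Strong limits of scaled resolvents\<close>

text \<open>Away from the point \<open>1 / l\<close> of the spectrum the resolvents stay bounded as the parameter
  approaches \<open>l\<close>, so that the factor \<open>\<mu>\<close> drives them to zero.\<close>

lemma scaled_resolvent_away_tendsto:
  assumes l: "l \<noteq> 0" and \<mu>: "\<And>n. \<mu> n > 0" "\<mu> \<longlonglongrightarrow> 0"
    and \<omega>: "\<omega> \<in> sets borel" and "e > 0" and \<sigma>: "\<bar>\<sigma>\<bar> = 1"
    and ge: "\<And>x. x \<in> \<omega> \<Longrightarrow> e \<le> \<sigma> * (x - 1 / l)" and g: "E \<omega> g = g"
  shows "(\<lambda>n. (\<i> * complex_of_real (\<mu> n)) *\<^sub>C inv (fredholm T (Complex l (- \<mu> n))) g) \<longlonglongrightarrow> 0"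
proof -
  note S = selfadjoint_of_spectral
  obtain M where M: "M > 0" "\<And>f. norm (T f) \<le> norm f * M"
    using T bounded_linear.pos_bounded unfolding bounded_op_def by blast
  define c where "c = \<bar>l\<bar> * e"
  have c: "c > 0" using l \<open>e > 0\<close> by (simp add: c_def)
  have "(\<lambda>n. \<mu> n * M) \<longlonglongrightarrow> 0 * M" by (intro tendsto_intros \<mu>)
  then have ev: "\<forall>\<^sub>F n in sequentially. \<mu> n * M < c / 2"
    using c by (intro order_tendstoD(2)[of _ 0]) auto
  show ?thesis
  proof (rule Lim_null_comparison[where g = "\<lambda>n. \<mu> n * (2 * norm g / c)"])
    show "(\<lambda>n. \<mu> n * (2 * norm g / c)) \<longlonglongrightarrow> 0"
      using tendsto_mult_right[OF \<mu>(2), of "2 * norm g / c"] by simp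
    show "\<forall>\<^sub>F n in sequentially.
      norm ((\<i> * complex_of_real (\<mu> n)) *\<^sub>C inv (fredholm T (Complex l (- \<mu> n))) g) \<le> \<mu> n * (2 * norm g / c)"
      using ev
    proof eventually_elim
      case (elim n)
      have z: "Im (Complex l (- \<mu> n)) \<noteq> 0" using \<mu>(1)[of n] by simp
      define h where "h = inv (fredholm T (Complex l (- \<mu> n))) g"
      have Eh: "E \<omega> h = h" unfolding h_def by (rule spectral_inv_fredholm[OF \<omega> z g])
      have "e * (norm h)\<^sup>2 \<le> \<sigma> * inner (T h - (1 / l) *\<^sub>R h) h"
        by (rule spectral_form_ge[OF \<omega> ge Eh])
      also have "\<dots> \<le> \<bar>\<sigma> * inner (T h - (1 / l) *\<^sub>R h) h\<bar>" by (rule abs_ge_self)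
      also have "\<dots> \<le> norm (T h - (1 / l) *\<^sub>R h) * norm h"
        unfolding abs_mult \<sigma> using Cauchy_Schwarz_ineq2 by simp
      finally have "(e * norm h) * norm h \<le> norm (T h - (1 / l) *\<^sub>R h) * norm h"
        by (simp add: power2_eq_square mult.assoc)
      then have 1: "e * norm h \<le> norm (T h - (1 / l) *\<^sub>R h)"
        by (cases "norm h = 0") auto
      have "g = fredholm T (complex_of_real l) h + (\<i> * complex_of_real (\<mu> n)) *\<^sub>C T h"
        using fredholm_inv[OF S z, of g] by (simp add: h_def fredholm_shift)
      then have "l *\<^sub>R (T h - (1 / l) *\<^sub>R h) = (\<i> * complex_of_real (\<mu> n)) *\<^sub>C T h - g"
        using l by (simp add: fredholm_def cscale_of_real scaleR_diff_right)
      then have "\<bar>l\<bar> * norm (T h - (1 / l) *\<^sub>R h) = norm ((\<i> * complex_of_real (\<mu> n)) *\<^sub>C T h - g)"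
        by (metis norm_scaleR)
      also have "\<dots> \<le> \<mu> n * norm (T h) + norm g"
        using norm_triangle_ineq4[of "(\<i> * complex_of_real (\<mu> n)) *\<^sub>C T h" g] \<mu>(1)[of n]
        by (simp add: norm_cscale norm_mult)
      also have "\<dots> \<le> \<mu> n * (norm h * M) + norm g"
        using \<mu>(1)[of n] by (intro add_right_mono mult_left_mono M) auto
      also have "\<dots> \<le> c / 2 * norm h + norm g"
        using mult_right_mono[OF less_imp_le[OF elim], of "norm h"] by (simp add: mult.assoc mult.commute[of M])
      finally have "c * norm h \<le> c / 2 * norm h + norm g"
        using mult_left_mono[OF 1, of "\<bar>l\<bar>"] by (simp add: c_def mult.assoc)
      then have "norm h \<le> 2 * norm g / c"
        using c by (simp add: field_simps)
      then show ?case
        using \<mu>(1)[of n] unfolding h_def[symmetric] norm_cscale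
        by (simp only: norm_mult norm_ii norm_of_real) (simp only: abs_of_pos mult_1 mult_left_mono less_imp_le)
    qed
  qed
qed

text \<open>The spectrum is cut into the point \<open>1 / l\<close> and countably many pieces at positive
  distance from it, each on one side.\<close>

lemma scaled_resolvent_tendsto:
  assumes l: "l \<noteq> 0" and \<mu>: "\<And>n. \<mu> n > 0" "\<mu> \<longlonglongrightarrow> 0"
  shows "(\<lambda>n. (\<i> * complex_of_real (\<mu> n)) *\<^sub>C inv (fredholm T (Complex l (- \<mu> n))) f)
    \<longlonglongrightarrow> l *\<^sub>R E {1 / l} f"
proof -
  note S = selfadjoint_of_spectral
  define F where "F n f = (\<i> * complex_of_real (\<mu> n)) *\<^sub>C inv (fredholm T (Complex l (- \<mu> n))) f" for n f
  have z: "Im (Complex l (- \<mu> n)) \<noteq> 0" for n using \<mu>(1)[of n] by simp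
  have lin: "linear (F n)" for n
    unfolding F_def[abs_def] using inv_fredholm_bounded_op[OF S z[of n]]
    by (intro bounded_linear.linear bounded_linear_compose[OF bounded_linear_cscale])
      (simp add: bounded_op_def)
  obtain M where M: "\<And>n. \<mu> n \<le> M"
    using convergent_imp_Bseq[of \<mu>] \<mu>(2) unfolding Bseq_def convergent_def
    by (metis abs_ge_self order_trans real_norm_def)
  have bound: "norm (F n f) \<le> (\<bar>l\<bar> + M) * norm f" for n f
    unfolding F_def using M[of n]
    by (intro order_trans[OF scaled_resolvent_norm_le[OF S \<mu>(1)]] mult_right_mono) auto
  \<comment> \<open>The pieces are indexed by the integer part of the reciprocal distance to \<open>1 / l\<close>, which makes
    them disjoint, and the distance is at least \<open>1 / (k + 1)\<close> on the \<open>k\<close>-th one.\<close>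
  define V where "V \<sigma> k = {x. 0 < \<sigma> * (x - 1 / l) \<and> nat \<lfloor>1 / (\<sigma> * (x - 1 / l))\<rfloor> = k}" for \<sigma> :: real and k
  have V_borel: "V \<sigma> k \<in> sets borel" for \<sigma> k
    unfolding V_def by measurable
  have V_union: "(\<Union>k. V \<sigma> k) = {x. 0 < \<sigma> * (x - 1 / l)}" for \<sigma>
    by (auto simp: V_def)
  have side: "(\<lambda>n. F n (E (\<Union>k. V \<sigma> k) f)) \<longlonglongrightarrow> 0" if \<sigma>: "\<bar>\<sigma>\<bar> = 1" for \<sigma>
  proof (rule tendsto_zero_closure[OF lin bound])
    have "(\<lambda>k. E (V \<sigma> k) f) sums E (\<Union>k. V \<sigma> k) f"
      using V_borel by (intro spectral_sums) (auto simp: disjoint_family_on_def V_def)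
    then show "(\<lambda>N. \<Sum>k<N. E (V \<sigma> k) f) \<longlonglongrightarrow> E (\<Union>k. V \<sigma> k) f"
      by (simp add: sums_def)
    have "(\<lambda>n. F n (E (V \<sigma> k) f)) \<longlonglongrightarrow> 0" for k
      unfolding F_def
    proof (rule scaled_resolvent_away_tendsto[OF l \<mu> V_borel _ \<sigma>])
      show "E (V \<sigma> k) (E (V \<sigma> k) f) = E (V \<sigma> k) f" by (simp add: spectral_inter V_borel)
      fix x assume "x \<in> V \<sigma> k"
      then have pos: "0 < \<sigma> * (x - 1 / l)" and fl: "nat \<lfloor>1 / (\<sigma> * (x - 1 / l))\<rfloor> = k"
        by (auto simp: V_def)
      have "1 / (\<sigma> * (x - 1 / l)) < real_of_int \<lfloor>1 / (\<sigma> * (x - 1 / l))\<rfloor> + 1" by linarith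
      also have "real_of_int \<lfloor>1 / (\<sigma> * (x - 1 / l))\<rfloor> \<le> real k"
        unfolding fl[symmetric] by simp
      finally have "1 < (real k + 1) * (\<sigma> * (x - 1 / l))"
        using pos by (simp only: divide_less_eq)
      then show "1 / (real k + 1) \<le> \<sigma> * (x - 1 / l)"
        by (simp add: divide_le_eq mult.commute)
    qed simp
    then show "(\<lambda>n. F n (\<Sum>k<N. E (V \<sigma> k) f)) \<longlonglongrightarrow> 0" for N
      unfolding linear_sum[OF lin] by (intro tendsto_null_sum)
  qed
  have atom: "F n (E {1 / l} f) = l *\<^sub>R E {1 / l} f" for n
  proof -
    define g where "g = E {1 / l} f"
    have Tg: "T g = (1 / l) *\<^sub>R g"
      unfolding g_def by (rule spectral_eigenvector)
    then have "fredholm T (complex_of_real l) g = 0" using l by (simp add: fredholm_def cscale_of_real)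
    then have fr: "fredholm T (Complex l (- \<mu> n)) g
        = (\<i> * complex_of_real (\<mu> n) * complex_of_real (1 / l)) *\<^sub>C g"
      unfolding fredholm_shift Tg cscale_of_real[symmetric] by (simp add: cscale_cscale)
    let ?B = "inv (fredholm T (Complex l (- \<mu> n)))"
    have scale: "?B (c *\<^sub>C h) = c *\<^sub>C ?B h" for c h
      using inv_fredholm_bounded_op[OF S z[of n]] by (simp add: bounded_op_def)
    have "l *\<^sub>R g = complex_of_real l *\<^sub>C ?B (fredholm T (Complex l (- \<mu> n)) g)"
      by (simp add: inv_fredholm[OF S z] cscale_of_real)
    also have "\<dots> = F n g"
      unfolding fr scale cscale_cscale F_def using l by (simp add: mult.commute)
    finally show ?thesis unfolding g_def ..
  qed
  have split: "f = E {1 / l} f + (E (\<Union>k. V 1 k) f + E (\<Union>k. V (- 1) k) f)"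
  proof -
    have U: "(\<Union>k. V \<sigma> k) \<in> sets borel" for \<sigma> using V_borel by auto
    have "E ((\<Union>k. V 1 k) \<union> (\<Union>k. V (- 1) k)) f = E (\<Union>k. V 1 k) f + E (\<Union>k. V (- 1) k) f"
      using U[of 1] U[of "- 1"] by (rule spectral_union) (auto simp: V_union)
    moreover have "E ({1 / l} \<union> ((\<Union>k. V 1 k) \<union> (\<Union>k. V (- 1) k))) f
        = E {1 / l} f + E ((\<Union>k. V 1 k) \<union> (\<Union>k. V (- 1) k)) f"
      using U[of 1] U[of "- 1"] by (intro spectral_union) (auto simp: V_union)
    moreover have "{1 / l} \<union> ((\<Union>k. V 1 k) \<union> (\<Union>k. V (- 1) k)) = UNIV"
      unfolding V_union by auto
    ultimately show ?thesis by (simp add: spectral_UNIV)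
  qed
  have "F n f = l *\<^sub>R E {1 / l} f + (F n (E (\<Union>k. V 1 k) f) + F n (E (\<Union>k. V (- 1) k) f))" for n
    using arg_cong[OF split, of "F n"] by (simp only: linear_add[OF lin] atom)
  moreover have "(\<lambda>n. l *\<^sub>R E {1 / l} f + (F n (E (\<Union>k. V 1 k) f) + F n (E (\<Union>k. V (- 1) k) f)))
      \<longlonglongrightarrow> l *\<^sub>R E {1 / l} f + (0 + 0)"
    by (intro tendsto_add tendsto_const side) auto
  ultimately show ?thesis by (simp add: F_def)
qed

text \<open>On an eigenvector the scaled resolvents act as the constant factor \<open>l\<close>, so their strong limit
  \<open>l E {1 / l}\<close> must fix it.\<close>

lemma fredholm_kernel_iff_spectral:
  assumes l: "l \<noteq> 0"
  shows "fredholm T (complex_of_real l) f = 0 \<longleftrightarrow> E {1 / l} f = f"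
proof
  assume "E {1 / l} f = f"
  then have "T f = (1 / l) *\<^sub>R f" using spectral_eigenvector[of "1 / l" f] by simp
  then show "fredholm T (complex_of_real l) f = 0"
    using l by (simp add: fredholm_def cscale_of_real)
next
  note S = selfadjoint_of_spectral
  assume "fredholm T (complex_of_real l) f = 0"
  then have f: "l *\<^sub>R T f = f" by (simp add: fredholm_def cscale_of_real)
  define \<mu> where "\<mu> n = 1 / real (Suc n)" for n
  have \<mu>: "\<mu> n > 0" "\<mu> \<longlonglongrightarrow> 0" for n
    unfolding \<mu>_def[abs_def] using LIMSEQ_inverse_real_of_nat by (simp_all add: inverse_eq_divide)
  have "(\<i> * complex_of_real (\<mu> n)) *\<^sub>C inv (fredholm T (Complex l (- \<mu> n))) f = l *\<^sub>R f" for n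
  proof -
    have z: "Im (Complex l (- \<mu> n)) \<noteq> 0" using \<mu>(1)[of n] by simp
    have "fredholm T (complex_of_real l) f = 0" by (simp add: fredholm_def cscale_of_real f)
    then have "l *\<^sub>R fredholm T (Complex l (- \<mu> n)) f = (\<i> * complex_of_real (\<mu> n)) *\<^sub>C (l *\<^sub>R T f)"
      by (simp add: fredholm_shift cscale_scaleR)
    then have "l *\<^sub>R fredholm T (Complex l (- \<mu> n)) f = (\<i> * complex_of_real (\<mu> n)) *\<^sub>C f"
      by (simp add: f)
    then have "inv (fredholm T (Complex l (- \<mu> n))) ((\<i> * complex_of_real (\<mu> n)) *\<^sub>C f)
        = inv (fredholm T (Complex l (- \<mu> n))) (complex_of_real l *\<^sub>C fredholm T (Complex l (- \<mu> n)) f)"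
      by (simp add: cscale_of_real)
    then show ?thesis
      using inv_fredholm_bounded_op[OF S z]
      by (simp add: bounded_op_def linear_simps inv_fredholm[OF S z] cscale_of_real)
  qed
  then have "(\<lambda>n :: nat. l *\<^sub>R f) \<longlonglongrightarrow> l *\<^sub>R E {1 / l} f"
    using scaled_resolvent_tendsto[OF l \<mu>, of f] by simp
  then have "l *\<^sub>R f = l *\<^sub>R E {1 / l} f" by (simp add: LIMSEQ_const_iff)
  then show "E {1 / l} f = f" using l by simp
qed

text \<open>The identity \<open>(I - l T) B = I - \<i> \<mu> T B\<close> shows that the range of \<open>I - l T\<close> approximates every
  \<open>f\<close> when the scaled resolvents tend to zero.\<close>

lemma dense_range_of_trivial_atom:
  assumes l: "l \<noteq> 0" and zero: "\<And>f. E {1 / l} f = 0"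
  shows "closure (range (fredholm T (complex_of_real l))) = UNIV"
proof -
  note S = selfadjoint_of_spectral
  define \<mu> where "\<mu> n = 1 / real (Suc n)" for n
  have \<mu>: "\<mu> n > 0" "\<mu> \<longlonglongrightarrow> 0" for n
    unfolding \<mu>_def[abs_def] using LIMSEQ_inverse_real_of_nat by (simp_all add: inverse_eq_divide)
  define h where "h n f = inv (fredholm T (Complex l (- \<mu> n))) f" for n f
  have "(\<lambda>n. fredholm T (complex_of_real l) (h n f)) \<longlonglongrightarrow> f" for f
  proof -
    have "(\<lambda>n. T ((\<i> * complex_of_real (\<mu> n)) *\<^sub>C h n f)) \<longlonglongrightarrow> T (l *\<^sub>R E {1 / l} f)"
      unfolding h_def using T by (intro bounded_linear.tendsto[of T] scaled_resolvent_tendsto l \<mu>)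
        (simp add: bounded_op_def)
    then have "(\<lambda>n. f - T ((\<i> * complex_of_real (\<mu> n)) *\<^sub>C h n f)) \<longlonglongrightarrow> f - 0"
      using T by (intro tendsto_diff tendsto_const) (simp add: zero bounded_op_def linear_simps)
    moreover have "fredholm T (complex_of_real l) (h n f) = f - T ((\<i> * complex_of_real (\<mu> n)) *\<^sub>C h n f)" for n
    proof -
      have z: "Im (Complex l (- \<mu> n)) \<noteq> 0" using \<mu>(1)[of n] by simp
      show ?thesis
        using fredholm_inv[OF S z, of f]
        by (simp add: h_def[symmetric] fredholm_shift T_simps(3) eq_diff_eq)
    qed
    ultimately show ?thesis by simp
  qed
  then have "f \<in> closure (range (fredholm T (complex_of_real l)))" for f
    unfolding closure_sequential by (intro exI[of _ "\<lambda>n. fredholm T (complex_of_real l) (h n f)"]) auto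
  then show ?thesis by blast
qed

end

section \<open>Uniform convergence\<close>

text \<open>The closure of the range of a function in \<open>C0\<close> is compact, and on compact sets a
  bounded sequence of operators that converges strongly converges uniformly.\<close>

lemma uniform_limit_strong_C0:
  fixes F :: "nat \<Rightarrow> 'a :: real_normed_vector \<Rightarrow> 'b :: real_normed_vector" and k :: "real \<Rightarrow> 'a"
  assumes lin: "\<And>n. linear (F n)" and bound: "\<And>n f. norm (F n f) \<le> C * norm f"
    and lim: "\<And>f. (\<lambda>n. F n f) \<longlonglongrightarrow> 0" and k: "k \<in> C0"
  shows "uniform_limit UNIV (\<lambda>n s. F n (k s)) (\<lambda>_. 0) sequentially"
proof (rule uniform_limitI)
  fix e :: real assume "e > 0"
  define d where "d = e / (2 * (\<bar>C\<bar> + 1))"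
  have d: "d > 0" using \<open>e > 0\<close> by (simp add: d_def)
  have klim: "(k \<longlongrightarrow> 0) at_infinity" using k by (simp add: C0_def)
  obtain b where b: "\<And>s. norm s \<ge> b \<Longrightarrow> norm (k s) < d"
    using tendstoD[OF klim d] unfolding eventually_at_infinity dist_0_norm dist_norm diff_zero by blast
  have "continuous_on (cball 0 b) k"
    using k continuous_on_subset[of UNIV k "cball 0 b"] by (simp add: C0_def)
  then have "compact (k ` cball 0 b)"
    by (intro compact_continuous_image) auto
  then obtain D where D: "finite D" "k ` cball 0 b \<subseteq> (\<Union>x\<in>D. ball x d)"
    using d by (auto simp: compact_eq_totally_bounded)
  have net: "\<exists>x\<in>insert 0 D. norm (k s - x) < d" for s
  proof (cases "norm s \<ge> b")
    case True then show ?thesis using b by auto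
  next
    case False
    then have "k s \<in> k ` cball 0 b" by auto
    then have "k s \<in> (\<Union>x\<in>D. ball x d)" using D(2) by blast
    then show ?thesis by (auto simp: dist_norm norm_minus_commute)
  qed
  have "\<forall>\<^sub>F n in sequentially. \<forall>x\<in>insert 0 D. norm (F n x) < e / 2"
    using D(1) \<open>e > 0\<close> tendstoD[OF lim, of "e / 2"]
    by (intro eventually_ball_finite ballI) simp_all
  then show "\<forall>\<^sub>F n in sequentially. \<forall>s\<in>UNIV. dist (F n (k s)) 0 < e"
  proof eventually_elim
    case (elim n)
    show ?case
    proof
      fix s
      obtain x where x: "x \<in> insert 0 D" "norm (k s - x) < d" using net by blast
      have "norm (F n (k s)) = norm (F n x + F n (k s - x))"
        by (simp add: linear_diff[OF lin])
      also have "\<dots> \<le> norm (F n x) + norm (F n (k s - x))" by (rule norm_triangle_ineq)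
      also have "norm (F n (k s - x)) \<le> (\<bar>C\<bar> + 1) * norm (k s - x)"
        by (rule order_trans[OF bound]) (auto intro: mult_right_mono)
      also have "\<dots> \<le> (\<bar>C\<bar> + 1) * d" using x by (intro mult_left_mono) auto
      also have "\<dots> = e / 2" by (simp add: d_def field_simps)
      finally show "dist (F n (k s)) 0 < e" using bspec[OF elim x(1)] by simp
    qed
  qed
qed

lemma sup_norm_le: "(\<And>x. norm (f x) \<le> B) \<Longrightarrow> sup_norm f \<le> B"
  unfolding sup_norm_def by (rule cSUP_least) auto

lemma norm_le_sup_norm:
  assumes "bounded (range f)"
  shows "norm (f x) \<le> sup_norm f"
  unfolding sup_norm_def
  using assms by (intro cSUP_upper) (auto simp: bounded_iff bdd_above_def)

lemma C0_tendstoI: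
  assumes "\<And>n. F n \<in> C0" "f \<in> C0" and lim: "uniform_limit UNIV F f sequentially"
  shows "C0_tendsto F f"
proof -
  have "(\<lambda>n. sup_norm (\<lambda>x. F n x - f x)) \<longlonglongrightarrow> 0"
  proof (rule tendstoI)
    fix e :: real assume e: "e > 0"
    have "\<forall>\<^sub>F n in sequentially. \<forall>x\<in>UNIV. dist (F n x) (f x) < e / 2"
      using e by (intro uniform_limitD[OF lim]) simp
    then show "\<forall>\<^sub>F n in sequentially. dist (sup_norm (\<lambda>x. F n x - f x)) 0 < e"
    proof eventually_elim
      case (elim n)
      have le: "norm (F n x - f x) \<le> e / 2" for x
        using bspec[OF elim, of x] by (simp add: dist_norm)
      then have "bounded (range (\<lambda>x. F n x - f x))"
        unfolding bounded_iff by blast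
      from norm_le_sup_norm[OF this] have "norm (F n 0 - f 0) \<le> sup_norm (\<lambda>x. F n x - f x)" .
      then have "0 \<le> sup_norm (\<lambda>x. F n x - f x)"
        using norm_ge_zero order_trans by blast
      moreover have "sup_norm (\<lambda>x. F n x - f x) \<le> e / 2" by (rule sup_norm_le[OF le])
      ultimately show ?case using e by simp
    qed
  qed
  with assms show ?thesis by (simp add: C0_tendsto_def)
qed

lemma sup_norm_tendsto:
  fixes f :: "'a :: {real_normed_vector, heine_borel} \<Rightarrow> 'b :: real_normed_vector"
  assumes "C0_tendsto F f"
  shows "(\<lambda>n. sup_norm (F n)) \<longlonglongrightarrow> sup_norm f"
proof -
  have bd: "bounded (range (F n))" "bounded (range f)" for n
    using assms C0_bounded by (auto simp: C0_tendsto_def)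
  have bd': "bounded (range (\<lambda>x. F n x - f x))" for n
    using bd by (intro bounded_minus_comp)
  have "\<bar>sup_norm (F n) - sup_norm f\<bar> \<le> sup_norm (\<lambda>x. F n x - f x)" for n
  proof -
    have "norm (F n x) \<le> sup_norm f + sup_norm (\<lambda>x. F n x - f x)" for x
      using norm_triangle_sub[of "F n x" "f x"] norm_le_sup_norm[OF bd(2), of x]
        norm_le_sup_norm[OF bd'[of n], of x] by linarith
    moreover have "norm (f x) \<le> sup_norm (F n) + sup_norm (\<lambda>x. F n x - f x)" for x
      using norm_triangle_sub[of "f x" "F n x"] norm_le_sup_norm[OF bd(1)[of n], of x]
        norm_le_sup_norm[OF bd'[of n], of x] by (simp add: norm_minus_commute)
    ultimately have "sup_norm (F n) \<le> sup_norm f + sup_norm (\<lambda>x. F n x - f x)"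
      and "sup_norm f \<le> sup_norm (F n) + sup_norm (\<lambda>x. F n x - f x)"
      by (intro sup_norm_le; simp)+
    then show ?thesis by linarith
  qed
  moreover have "(\<lambda>n. sup_norm (\<lambda>x. F n x - f x)) \<longlonglongrightarrow> 0"
    using assms by (simp add: C0_tendsto_def)
  ultimately have "(\<lambda>n. sup_norm (F n) - sup_norm f) \<longlonglongrightarrow> 0"
    using Lim_null_comparison[of "\<lambda>n. sup_norm (F n) - sup_norm f" "\<lambda>n. sup_norm (\<lambda>x. F n x - f x)"]
    by simp
  then show ?thesis by (rule LIM_zero_cancel)
qed

lemma cutoff_complement_uniform_limit:
  assumes r: "filterlim r at_top sequentially" and k: "k \<in> C0"
  shows "uniform_limit UNIV (\<lambda>n s. k s - cutoff (r n) (k s)) (\<lambda>_ :: real. 0) sequentially"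
proof (rule uniform_limit_strong_C0[where C = 1])
  show "linear (\<lambda>f. f - cutoff (r n) f)" for n
    using cutoff_bounded_op[of "r n"]
    by (intro bounded_linear.linear bounded_linear_sub bounded_linear_ident) (simp add: bounded_op_def)
qed (use k in \<open>auto intro: norm_cutoff_complement_le cutoff_tendsto[OF r]\<close>)

text \<open>Outside the truncation interval the truncated function is zero, and \<open>k\<close> itself is small there
  once the interval is large.\<close>

lemma truncated_C0_uniform_limit:
  assumes r: "filterlim r at_top sequentially" and k: "k \<in> C0"
  shows "uniform_limit UNIV (\<lambda>n s. k s - indicator {- r n<..<r n} s *\<^sub>R cutoff (r n) (k s))
    (\<lambda>_ :: real. 0) sequentially"
proof (rule uniform_limitI)
  fix e :: real assume e: "e > 0"
  have klim: "(k \<longlongrightarrow> 0) at_infinity" using k by (simp add: C0_def)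
  obtain b where b: "\<And>s. norm s \<ge> b \<Longrightarrow> norm (k s) < e"
    using tendstoD[OF klim e] unfolding eventually_at_infinity dist_0_norm dist_norm diff_zero by blast
  have "\<forall>\<^sub>F n in sequentially. b < r n"
    using r by (simp add: filterlim_at_top_dense)
  moreover have "\<forall>\<^sub>F n in sequentially. \<forall>s\<in>UNIV. dist (k s - cutoff (r n) (k s)) 0 < e"
    by (rule uniform_limitD[OF cutoff_complement_uniform_limit[OF r k] e])
  ultimately show "\<forall>\<^sub>F n in sequentially. \<forall>s\<in>UNIV.
      dist (k s - indicator {- r n<..<r n} s *\<^sub>R cutoff (r n) (k s)) 0 < e"
  proof eventually_elim
    case (elim n)
    show ?case
    proof
      fix s
      show "dist (k s - indicator {- r n<..<r n} s *\<^sub>R cutoff (r n) (k s)) 0 < e"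
      proof (cases "s \<in> {- r n<..<r n}")
        case True
        then show ?thesis using bspec[OF elim(2), of s] by simp
      next
        case False
        then have "norm s \<ge> b" using elim(1) by auto
        with False show ?thesis using b[of s] by simp
      qed
    qed
  qed
qed

lemma sup_norm_scale:
  assumes f: "bounded (range f)" and "c > 0" and g: "\<And>x. norm (g x) = c * norm (f x)"
  shows "sup_norm g = c * sup_norm f"
proof (rule antisym)
  show le: "sup_norm g \<le> c * sup_norm f"
    using \<open>c > 0\<close> norm_le_sup_norm[OF f] by (intro sup_norm_le) (simp add: g)
  have "norm (g x) \<le> c * sup_norm f" for x
    using \<open>c > 0\<close> norm_le_sup_norm[OF f, of x] by (simp add: g)
  then have bg: "bounded (range g)" unfolding bounded_iff by blast
  have "sup_norm f \<le> sup_norm g / c"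
  proof (rule sup_norm_le)
    show "norm (f x) \<le> sup_norm g / c" for x
      using norm_le_sup_norm[OF bg, of x] \<open>c > 0\<close> by (simp add: g field_simps)
  qed
  then show "c * sup_norm f \<le> sup_norm g"
    using \<open>c > 0\<close> by (simp add: field_simps)
qed

lemma selfadjoint_compression: "selfadjoint T \<Longrightarrow> selfadjoint (cutoff r \<circ> T \<circ> cutoff r)"
  unfolding selfadjoint_def by (auto intro!: bounded_op_comp cutoff_bounded_op simp: cutoff_selfadjoint)

section \<open>Resolvent kernels of truncations and the spectral kernel\<close>

context
  fixes K :: "real \<Rightarrow> real \<Rightarrow> complex" and T :: "L2 \<Rightarrow> L2" and r m :: real and l :: real
    and z :: complex and k R :: "real \<Rightarrow> L2"
  assumes K: "K0_kernel K" and T: "induces K T" "selfadjoint T"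
    and cut: "K0_kernel (square_cut r K)" and m: "m > 0"
  defines "z \<equiv> Complex l (- m)" and "k \<equiv> carleman K"
    and "R \<equiv> carleman (resolvent_kernel (square_cut r K) (Complex l m))"
begin

lemma z_nonreal: "Im z \<noteq> 0" "Im (Complex l m) \<noteq> 0" "cnj (Complex l m) = z"
  using m by (simp_all add: z_def complex_eq_iff)

lemma T_linear:
  "T (f + g) = T f + T g" "T (f - g) = T f - T g" "T (c *\<^sub>C f) = c *\<^sub>C T f"
  "T 0 = 0"
  using T(2) by (auto simp: selfadjoint_def bounded_op_def linear_simps)

lemma P_linear:
  "cutoff r (f + g) = cutoff r f + cutoff r g" "cutoff r (f - g) = cutoff r f - cutoff r g"
  "cutoff r (c *\<^sub>C f) = c *\<^sub>C cutoff r f" "cutoff r (a *\<^sub>R f) = a *\<^sub>R cutoff r f"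
  using cutoff_bounded_op[of r] by (auto simp: bounded_op_def linear_simps)

lemma cut_resolvent_kernel:
  shows "K0_kernel (resolvent_kernel (square_cut r K) (Complex l m))"
    and "fredholm (cutoff r \<circ> T \<circ> cutoff r) z (R s) = indicator {-r<..<r} s *\<^sub>R cutoff r (k s)"
    and "resolvent_kernel (square_cut r K) (Complex l m) s t = square_cut r K s t
      + Complex l m * cinner (indicator {-r<..<r} t *\<^sub>R cutoff r (k t)) (R s)"
proof -
  note S = square_cut_induces[OF K T(1), of r] selfadjoint_compression[OF T(2), of r]
  note res = resolvent_kernel_nonreal[OF cut S z_nonreal(2), folded R_def, unfolded z_nonreal(3)
      carleman_square_cut[OF K], folded k_def]
  show "K0_kernel (resolvent_kernel (square_cut r K) (Complex l m))"
    and "resolvent_kernel (square_cut r K) (Complex l m) s t = square_cut r K s t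
      + Complex l m * cinner (indicator {-r<..<r} t *\<^sub>R cutoff r (k t)) (R s)"
    by (rule res)+
  show "fredholm (cutoff r \<circ> T \<circ> cutoff r) z (R s) = indicator {-r<..<r} s *\<^sub>R cutoff r (k s)"
    unfolding res(2) by (rule fredholm_inv[OF S(2) z_nonreal(1)])
qed

lemma cutoff_cut_resolvent: "cutoff r (R s) = R s"
proof -
  have R: "R s = indicator {-r<..<r} s *\<^sub>R cutoff r (k s) + z *\<^sub>C cutoff r (T (cutoff r (R s)))"
    using cut_resolvent_kernel(2)[of s] by (simp add: fredholm_def diff_eq_eq)
  show ?thesis
    by (subst R, subst (2) R) (simp add: P_linear cutoff_idem)
qed

text \<open>Both \<open>P k(s)\<close> and \<open>P T P R(s)\<close> are supported in the truncation interval, so \<open>R(s)\<close> is as well,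
  and the inner truncation can be dropped.\<close>

lemma cut_resolvent_eq:
  "R s - z *\<^sub>C cutoff r (T (R s)) = indicator {-r<..<r} s *\<^sub>R cutoff r (k s)"
  using cut_resolvent_kernel(2)[of s] by (simp add: fredholm_def cutoff_cut_resolvent)

lemma cut_resolvent_outside: "s \<notin> {-r<..<r} \<Longrightarrow> R s = 0"
proof -
  assume "s \<notin> {-r<..<r}"
  then have "fredholm (cutoff r \<circ> T \<circ> cutoff r) z (R s) = 0"
    using cut_resolvent_kernel(2)[of s] by simp
  then show "R s = 0"
    using fredholm_bounded_below[OF selfadjoint_compression[OF T(2), of r] z_nonreal(1), of "R s"]
      z_nonreal(1) by (simp add: mult_le_0_iff)
qed

text \<open>The double integral of the tail condition is the squared norm of the part of
  \<open>T R(s)\<close> outside the truncation interval.\<close>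

lemma tail_integral:
  "(\<integral>\<^sup>+ t\<in>- {-r<..<r}. ennreal ((cmod (LINT \<xi>:{-r<..<r}|lborel.
      K t \<xi> * cnj (resolvent_kernel (square_cut r K) (Complex l m) s \<xi>)))\<^sup>2) \<partial>lborel)
    = ennreal ((norm (T (R s) - cutoff r (T (R s))))\<^sup>2)"
proof -
  let ?L = "resolvent_kernel (square_cut r K) (Complex l m)"
  have "sq_integrable (?L s)"
    using cut_resolvent_kernel(1) by (rule K0_kernel_sq_integrable)
  note Ls = this rep_L2_carleman[of ?L s, OF this, folded R_def]
  have [measurable]: "?L s \<in> borel_measurable borel" "K t \<in> borel_measurable borel" for t
    using Ls K0_kernel_sq_integrable[OF K] by (auto simp: sq_integrable_def)
  have int: "(LINT \<xi>:{-r<..<r}|lborel. K t \<xi> * cnj (?L s \<xi>)) = cinner (R s) (k t)" for t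
  proof -
    have ae: "AE \<xi> in lborel. rep_L2 (R s) \<xi> = indicator {-r<..<r} \<xi> * cnj (?L s \<xi>)"
      using rep_L2_cutoff[of r "R s"] Ls(2) unfolding cutoff_cut_resolvent
      by eventually_elim simp
    have "cinner (R s) (k t) = (\<integral>\<xi>. K t \<xi> * rep_L2 (R s) \<xi> \<partial>lborel)"
      unfolding k_def by (rule cinner_carleman[OF K0_kernel_sq_integrable[OF K]])
    also have "\<dots> = (\<integral>\<xi>. K t \<xi> * (indicator {-r<..<r} \<xi> * cnj (?L s \<xi>)) \<partial>lborel)"
      by (rule integral_cong_AE) (use ae in auto)
    also have "\<dots> = (LINT \<xi>:{-r<..<r}|lborel. K t \<xi> * cnj (?L s \<xi>))"
      unfolding set_lebesgue_integral_def
      by (rule Bochner_Integration.integral_cong) (auto simp: indicator_def)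
    finally show ?thesis ..
  qed
  have "AE t in lborel. rep_L2 (T (R s)) t = cinner (R s) (k t)"
    using T(1) by (simp add: induces_iff[OF K] k_def)
  then show ?thesis
    unfolding norm_cutoff_complement_square int
    by (intro nn_integral_cong_AE) auto
qed

text \<open>Comparison of the truncated resolvent with the full one: apply \<open>I - z T\<close> to
  \<open>R(s)\<close>; what remains besides the Carleman function is the truncation error of the latter and the
  tail.\<close>

lemma cut_resolvent_diff_le:
  "norm ((\<i> * complex_of_real m) *\<^sub>C R s - (\<i> * complex_of_real m) *\<^sub>C inv (fredholm T z) (k s))
    \<le> (\<bar>l\<bar> + m) * (norm (k s - indicator {-r<..<r} s *\<^sub>R cutoff r (k s))
        + (\<bar>l\<bar> + m) * norm (T (R s) - cutoff r (T (R s))))"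
proof -
  let ?q = "k s - indicator {-r<..<r} s *\<^sub>R cutoff r (k s)" and ?t = "T (R s) - cutoff r (T (R s))"
  let ?B = "inv (fredholm T z)"
  interpret B: bounded_linear ?B
    using inv_fredholm_bounded_op[OF T(2) z_nonreal(1)] by (simp add: bounded_op_def)
  define u where "u = ?q + z *\<^sub>C ?t"
  have "fredholm T z (R s) = k s - u"
    using cut_resolvent_eq[of s] by (simp add: u_def fredholm_def cscale_diff_right algebra_simps)
  with inv_fredholm[OF T(2) z_nonreal(1), of "R s"]
  have "R s = ?B (k s - u)" by simp
  then have "R s - ?B (k s) = - ?B u" by (simp add: B.diff)
  then have "(\<i> * complex_of_real m) *\<^sub>C R s - (\<i> * complex_of_real m) *\<^sub>C ?B (k s)
      = - ((\<i> * complex_of_real m) *\<^sub>C ?B u)"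
    by (simp only: cscale_diff_right[symmetric] cscale_minus_right)
  also have "norm \<dots> \<le> (\<bar>l\<bar> + m) * norm u"
    unfolding norm_minus_cancel z_def by (rule scaled_resolvent_norm_le[OF T(2) m])
  also have "norm u \<le> norm ?q + cmod z * norm ?t"
    using norm_triangle_ineq[of ?q "z *\<^sub>C ?t"] by (simp add: u_def norm_cscale)
  also have "cmod z * norm ?t \<le> (\<bar>l\<bar> + m) * norm ?t"
    using cmod_le[of z] m by (intro mult_right_mono) (auto simp: z_def)
  finally show ?thesis using m by (simp add: mult_left_mono)
qed

text \<open>For a fixed nonreal parameter the tail is controlled by the truncation errors of the full
  resolvent, because \<open>I - z P T P\<close> maps \<open>R(s) - P \<rho>\<close>, with \<open>\<rho> = (I - z T)\<^sup>-\<^sup>1 k(s)\<close>, to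
  \<open>- z P T (\<rho> - P \<rho>)\<close>.\<close>

lemma cut_resolvent_tail_le:
  assumes M: "\<And>f. norm (T f) \<le> M * norm f" "M \<ge> 0" and s: "s \<in> {-r<..<r}"
  defines "\<rho> \<equiv> inv (fredholm T z) (k s)"
  shows "norm (T (R s) - cutoff r (T (R s))) \<le> norm (T \<rho> - cutoff r (T \<rho>))
    + M * (1 + cmod z / m * (cmod z * M)) * norm (\<rho> - cutoff r \<rho>)"
proof -
  let ?P = "cutoff r"
  have "\<rho> - z *\<^sub>C T \<rho> = k s"
    using fredholm_inv[OF T(2) z_nonreal(1), of "k s"] by (simp add: \<rho>_def fredholm_def)
  then have k: "k s = \<rho> - z *\<^sub>C T \<rho>" ..
  have "R s - z *\<^sub>C ?P (T (R s)) = ?P \<rho> - z *\<^sub>C ?P (T \<rho>)"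
    using cut_resolvent_eq[of s] s by (simp add: k P_linear)
  then have "fredholm (?P \<circ> T \<circ> ?P) z (R s - ?P \<rho>) = - (z *\<^sub>C ?P (T (\<rho> - ?P \<rho>)))"
    by (simp add: fredholm_def P_linear T_linear cutoff_idem cutoff_cut_resolvent
        cscale_diff_right algebra_simps)
  then have "\<bar>Im z\<bar> * norm (R s - ?P \<rho>) \<le> cmod z * norm (z *\<^sub>C ?P (T (\<rho> - ?P \<rho>)))"
    using fredholm_bounded_below[OF selfadjoint_compression[OF T(2), of r] z_nonreal(1), of "R s - ?P \<rho>"]
    by simp
  also have "\<dots> \<le> cmod z * (cmod z * (M * norm (\<rho> - ?P \<rho>)))"
    unfolding norm_cscale
    by (intro mult_left_mono order_trans[OF norm_cutoff_le] M) auto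
  finally have "norm (R s - ?P \<rho>) \<le> cmod z / m * (cmod z * M) * norm (\<rho> - ?P \<rho>)"
    using m by (simp add: z_def field_simps)
  moreover have "norm (R s - \<rho>) \<le> norm (R s - ?P \<rho>) + norm (\<rho> - ?P \<rho>)"
    using norm_triangle_ineq4[of "R s - ?P \<rho>" "\<rho> - ?P \<rho>"] by simp
  ultimately have diff: "norm (R s - \<rho>) \<le> (1 + cmod z / m * (cmod z * M)) * norm (\<rho> - ?P \<rho>)"
    by (simp add: distrib_right)
  have "T (R s) - ?P (T (R s)) = (T \<rho> - ?P (T \<rho>)) + (T (R s - \<rho>) - ?P (T (R s - \<rho>)))"
    by (simp add: T_linear P_linear)
  also have "norm \<dots> \<le> norm (T \<rho> - ?P (T \<rho>)) + norm (T (R s - \<rho>) - ?P (T (R s - \<rho>)))"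
    by (rule norm_triangle_ineq)
  also have "norm (T (R s - \<rho>) - ?P (T (R s - \<rho>))) \<le> M * norm (R s - \<rho>)"
    by (rule order_trans[OF norm_cutoff_complement_le M(1)])
  also have "\<dots> \<le> M * ((1 + cmod z / m * (cmod z * M)) * norm (\<rho> - ?P \<rho>))"
    by (rule mult_left_mono[OF diff M(2)])
  finally show ?thesis by (simp add: mult.assoc)
qed

end

text \<open>Since \<open>T Q = Q / l\<close> for \<open>Q = E {1 / l}\<close>, the projection is the sandwich \<open>Q = l\<^sup>2 T Q T\<close>.\<close>

lemma spectral_kernel_eq:
  assumes K: "K0_kernel K" and T: "induces K T" and E: "resolution_of_identity T E" and l: "l \<noteq> 0"
  shows "K0_kernel (spectral_kernel E {1 / l})"
    and "induces (spectral_kernel E {1 / l}) (E {1 / l})"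
    and "carleman (spectral_kernel E {1 / l}) s = l *\<^sub>R E {1 / l} (carleman K s)"
    and "spectral_kernel E {1 / l} s t
      = complex_of_real l * cinner (carleman K t) (l *\<^sub>R E {1 / l} (carleman K s))"
proof -
  let ?Q = "E {1 / l}"
  have bop: "bounded_op T" using T by (simp add: induces_def)
  note S = selfadjoint_of_spectral[OF E bop] and TE = T_simps[OF E bop]
  have Q: "bounded_op ?Q" "\<And>f g. cinner (?Q f) g = cinner f (?Q g)"
    using spectral_projection[OF E bop] by auto
  have eig: "T (?Q f) = (1 / l) *\<^sub>R ?Q f" for f by (rule spectral_eigenvector[OF E bop])
  define G where "G = (\<lambda>s t. cinner (?Q (carleman K t)) (carleman K s))"
  note G = sandwich_kernel[OF K T S Q(1) Q(1) Q(2), folded G_def]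
  define a where "a = complex_of_real (l\<^sup>2)"
  have a: "a *\<^sub>C v = l\<^sup>2 *\<^sub>R v" for v unfolding a_def by (rule cscale_of_real)
  \<comment> \<open>A scalar multiple, written as a linear combination with a second coefficient zero.\<close>
  define M where "M = (\<lambda>s t. a * G s t + 0 * G s t)"
  note M = K0_kernel_lincomb[OF G(1) G(1), where a = a and b = 0, folded M_def]
  have "(\<lambda>f. a *\<^sub>C (T \<circ> ?Q \<circ> T) f + 0 *\<^sub>C (T \<circ> ?Q \<circ> T) f) = ?Q"
  proof
    fix f
    have "T (?Q (T f)) = (1 / l) *\<^sub>R T (?Q f)"
      using spectral_commute[OF E bop, of "{1 / l}" f] eig[of "T f"] by simp
    then show "a *\<^sub>C (T \<circ> ?Q \<circ> T) f + 0 *\<^sub>C (T \<circ> ?Q \<circ> T) f = ?Q f"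
      using l by (simp add: eig a power2_eq_square)
  qed
  with M(3)[OF G(3) G(3)] have ind: "induces M ?Q" by simp
  have eq: "spectral_kernel E {1 / l} = M"
    unfolding spectral_kernel_def by (rule kernel_inducing_eq[OF M(1) ind])
  show "K0_kernel (spectral_kernel E {1 / l})" "induces (spectral_kernel E {1 / l}) ?Q"
    unfolding eq by (rule M(1), rule ind)
  show "carleman (spectral_kernel E {1 / l}) s = l *\<^sub>R ?Q (carleman K s)"
    unfolding eq M(2) G(2) eig
    using l a by (simp add: a_def power2_eq_square)
  show "spectral_kernel E {1 / l} s t
      = complex_of_real l * cinner (carleman K t) (l *\<^sub>R ?Q (carleman K s))"
    unfolding eq M_def G_def
    by (simp add: a_def Q(2) power2_eq_square cscale_of_real[symmetric] cinner_scale_right)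
qed

section \<open>Convergence along vanishing tails\<close>

context
  fixes K :: "real \<Rightarrow> real \<Rightarrow> complex" and T :: "L2 \<Rightarrow> L2" and E :: "real set \<Rightarrow> L2 \<Rightarrow> L2"
    and \<tau> \<mu> :: "nat \<Rightarrow> real" and l :: real
    and k :: "real \<Rightarrow> L2" and R :: "nat \<Rightarrow> nat \<Rightarrow> real \<Rightarrow> L2" and tail :: "nat \<Rightarrow> nat \<Rightarrow> real \<Rightarrow> L2"
  assumes K: "K0_kernel K" and T: "induces K T"
    and \<tau>: "filterlim \<tau> at_top sequentially"
    and cut: "\<And>n. n \<ge> 1 \<Longrightarrow> K0_kernel (square_cut (\<tau> n) K)"
    and E: "resolution_of_identity T E"
    and l: "l \<noteq> 0" and \<mu>: "\<And>n. \<mu> n > 0" "\<mu> \<longlonglongrightarrow> 0"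
  defines "k \<equiv> carleman K"
    and "R \<equiv> \<lambda>m n. carleman (cut_resolvent K \<tau> m (Complex l (\<mu> n)))"
    and "tail \<equiv> \<lambda>m n s. T (R m n s) - cutoff (\<tau> m) (T (R m n s))"
begin

lemma T_bounded: "bounded_op T"
  using T by (simp add: induces_def)

lemma T_selfadjoint: "selfadjoint T"
  by (rule selfadjoint_of_spectral[OF E T_bounded])

lemma k_C0: "k \<in> C0"
  using K by (simp add: k_def K0_kernel_def)

lemma vanishing_tails_iff:
  assumes m: "\<And>n. m n \<ge> 1"
  shows "vanishing_tails K \<tau> l \<mu> m \<longleftrightarrow>
    (\<lambda>n. SUP s\<in>{- \<tau> (m n)<..<\<tau> (m n)}. ennreal ((norm (tail (m n) n s))\<^sup>2)) \<longlonglongrightarrow> 0"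
  unfolding vanishing_tails_def tail_def R_def cut_resolvent_def
  by (simp only: tail_integral[OF K T T_selfadjoint cut[OF m] \<mu>(1)])

text \<open>Outside the truncation interval there is nothing to control, which turns the supremum over the
  interval into uniform convergence on the whole line.\<close>

lemma tail_outside:
  assumes "m \<ge> 1" "s \<notin> {- \<tau> m<..<\<tau> m}"
  shows "tail m n s = 0"
proof -
  have "R m n s = 0"
    unfolding R_def cut_resolvent_def
    using cut_resolvent_outside[OF K T T_selfadjoint cut[OF assms(1)] \<mu>(1) assms(2)] .
  then show ?thesis
    using T_bounded cutoff_bounded_op[of "\<tau> m"]
    by (simp add: tail_def bounded_op_def linear_simps)
qed

lemma tail_uniform_limit:
  assumes m: "\<And>n. m n \<ge> 1" and van: "vanishing_tails K \<tau> l \<mu> m"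
  shows "uniform_limit UNIV (\<lambda>n. tail (m n) n) (\<lambda>_. 0) sequentially"
proof (rule uniform_limitI)
  fix e :: real assume e: "e > 0"
  have "(\<lambda>n. SUP s\<in>{- \<tau> (m n)<..<\<tau> (m n)}. ennreal ((norm (tail (m n) n s))\<^sup>2)) \<longlonglongrightarrow> 0"
    using van vanishing_tails_iff[of m, OF m] by simp
  then have "\<forall>\<^sub>F n in sequentially.
      (SUP s\<in>{- \<tau> (m n)<..<\<tau> (m n)}. ennreal ((norm (tail (m n) n s))\<^sup>2)) < ennreal (e\<^sup>2)"
    by (rule order_tendstoD(2)) (use e in simp)
  then show "\<forall>\<^sub>F n in sequentially. \<forall>s\<in>UNIV. dist (tail (m n) n s) 0 < e"
  proof eventually_elim
    case (elim n)
    show ?case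
    proof
      fix s
      show "dist (tail (m n) n s) 0 < e"
      proof (cases "s \<in> {- \<tau> (m n)<..<\<tau> (m n)}")
        case True
        have "ennreal ((norm (tail (m n) n s))\<^sup>2) < ennreal (e\<^sup>2)"
          by (rule le_less_trans[OF SUP_upper[OF True] elim])
        then have "(norm (tail (m n) n s))\<^sup>2 < e\<^sup>2" by (simp add: ennreal_less_iff)
        then show ?thesis using e by (simp add: power2_less_imp_less)
      next
        case False
        then show ?thesis using tail_outside[OF m False] e by simp
      qed
    qed
  qed
qed

text \<open>For each fixed \<open>n\<close> the tails vanish uniformly as the truncation grows, so the truncation
  index only has to be taken large enough in terms of \<open>n\<close>.\<close>

lemma tail_eventually_small:
  assumes e: "e > 0"
  shows "\<forall>\<^sub>F m in sequentially. \<forall>s\<in>{- \<tau> m<..<\<tau> m}. norm (tail m n s) < e"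
proof -
  let ?z = "Complex l (- \<mu> n)"
  have z: "Im ?z \<noteq> 0" using \<mu>(1)[of n] by simp
  obtain M where M: "M > 0" "\<And>f. norm (T f) \<le> norm f * M"
    using T_bounded bounded_linear.pos_bounded unfolding bounded_op_def by blast
  have M': "norm (T f) \<le> M * norm f" "M \<ge> 0" for f
    using M(1) M(2)[of f] by (simp_all add: mult.commute)
  define \<rho> where "\<rho> s = inv (fredholm T ?z) (k s)" for s
  define c where "c = M * (1 + cmod ?z / \<mu> n * (cmod ?z * M))"
  have \<rho>: "\<rho> \<in> C0"
    unfolding \<rho>_def using inv_fredholm_bounded_op[OF T_selfadjoint z]
    by (intro C0_linear[OF k_C0]) (simp add: bounded_op_def)
  have T\<rho>: "(\<lambda>s. T (\<rho> s)) \<in> C0"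
    using T_bounded by (intro C0_linear[OF \<rho>]) (simp add: bounded_op_def)
  have "c \<ge> 0" using M'(2) \<mu>(1)[of n] by (simp add: c_def)
  define d where "d = e / (2 * (c + 1))"
  have d: "d > 0" using e \<open>c \<ge> 0\<close> by (simp add: d_def)
  have "\<forall>\<^sub>F m in sequentially. \<forall>s\<in>UNIV. dist (\<rho> s - cutoff (\<tau> m) (\<rho> s)) 0 < d"
    by (rule uniform_limitD[OF cutoff_complement_uniform_limit[OF \<tau> \<rho>] d])
  moreover have "\<forall>\<^sub>F m in sequentially. \<forall>s\<in>UNIV. dist (T (\<rho> s) - cutoff (\<tau> m) (T (\<rho> s))) 0 < e / 2"
    by (rule uniform_limitD[OF cutoff_complement_uniform_limit[OF \<tau> T\<rho>]]) (use e in simp)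
  moreover have "\<forall>\<^sub>F m in sequentially. m \<ge> (1::nat)"
    by (rule eventually_ge_at_top)
  ultimately show ?thesis
  proof eventually_elim
    case (elim m)
    show ?case
    proof
      fix s assume s: "s \<in> {- \<tau> m<..<\<tau> m}"
      have "norm (tail m n s) \<le> norm (T (\<rho> s) - cutoff (\<tau> m) (T (\<rho> s))) + c * norm (\<rho> s - cutoff (\<tau> m) (\<rho> s))"
        unfolding tail_def R_def cut_resolvent_def \<rho>_def c_def k_def
        by (rule cut_resolvent_tail_le[OF K T T_selfadjoint cut[OF elim(3)] \<mu>(1) M' s])
      also have "c * norm (\<rho> s - cutoff (\<tau> m) (\<rho> s)) \<le> c * d"
        using bspec[OF elim(1), of s] \<open>c \<ge> 0\<close> by (intro mult_left_mono) auto
      also have "c * d \<le> e / 2"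
        using \<open>c \<ge> 0\<close> e by (simp add: d_def field_simps)
      finally show "norm (tail m n s) < e" using bspec[OF elim(2), of s] by simp
    qed
  qed
qed

lemma vanishing_tails_exist: "\<exists>m :: nat \<Rightarrow> nat. strict_mono m \<and> (\<forall>n. m n \<ge> 1) \<and> vanishing_tails K \<tau> l \<mu> m"
proof -
  have "\<exists>N. \<forall>m\<ge>N. \<forall>s\<in>{- \<tau> m<..<\<tau> m}. norm (tail m n s) < 1 / real (Suc n)" for n
    using tail_eventually_small[of "1 / real (Suc n)" n] by (simp add: eventually_sequentially)
  then obtain N where N: "\<And>n m s. m \<ge> N n \<Longrightarrow> s \<in> {- \<tau> m<..<\<tau> m} \<Longrightarrow> norm (tail m n s) < 1 / real (Suc n)"
    by metis
  \<comment> \<open>The sum dominates every bound so far, and the summand \<open>Suc n\<close> makes the sequence strictly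
    increasing and positive.\<close>
  define m where "m n = Suc n + (\<Sum>i\<le>n. N i)" for n
  have "strict_mono m"
    by (rule strict_monoI_Suc) (simp add: m_def)
  have m1: "m n \<ge> 1" for n by (simp add: m_def)
  have mN: "m n \<ge> N n" for n
    using member_le_sum[of n "{..n}" N] by (simp add: m_def)
  have "(\<lambda>n. SUP s\<in>{- \<tau> (m n)<..<\<tau> (m n)}. ennreal ((norm (tail (m n) n s))\<^sup>2)) \<longlonglongrightarrow> 0"
  proof (rule tendsto_sandwich[OF always_eventually always_eventually tendsto_const])
    show "\<forall>n. (SUP s\<in>{- \<tau> (m n)<..<\<tau> (m n)}. ennreal ((norm (tail (m n) n s))\<^sup>2))
        \<le> ennreal ((1 / real (Suc n))\<^sup>2)"
      by (intro allI SUP_least ennreal_leI power_mono less_imp_le[OF N[OF mN]]) auto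
    have "(\<lambda>n. (1 / real (Suc n))\<^sup>2) \<longlonglongrightarrow> 0\<^sup>2"
      using LIMSEQ_inverse_real_of_nat by (intro tendsto_power) (simp add: inverse_eq_divide)
    from tendsto_ennrealI[OF this]
    show "(\<lambda>n. ennreal ((1 / real (Suc n))\<^sup>2)) \<longlonglongrightarrow> 0" by simp
  qed simp
  then show ?thesis
    using \<open>strict_mono m\<close> m1 vanishing_tails_iff[of m, OF m1] by blast
qed

text \<open>The truncated resolvents are compared with the full ones, and these converge uniformly because
  they converge strongly and \<open>k\<close> has a relatively compact range.\<close>

lemma carleman_uniform_limit:
  assumes m: "strict_mono m" "\<And>n. m n \<ge> 1" and van: "vanishing_tails K \<tau> l \<mu> m"
  shows "uniform_limit UNIV (\<lambda>n s. (\<i> * complex_of_real (\<mu> n)) *\<^sub>C R (m n) n s)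
    (\<lambda>s. l *\<^sub>R E {1 / l} (k s)) sequentially"
proof -
  define F where "F n f = (\<i> * complex_of_real (\<mu> n)) *\<^sub>C inv (fredholm T (Complex l (- \<mu> n))) f" for n f
  have z: "Im (Complex l (- \<mu> n)) \<noteq> 0" for n using \<mu>(1)[of n] by simp
  obtain M where M: "\<And>n. \<mu> n \<le> M"
    using convergent_imp_Bseq[of \<mu>] \<mu>(2) unfolding Bseq_def convergent_def
    by (metis abs_ge_self order_trans real_norm_def)
  have "M > 0" using \<mu>(1)[of 0] M[of 0] by simp
  have bound: "norm (F n f) \<le> (\<bar>l\<bar> + M) * norm f" for n f
    unfolding F_def using M[of n]
    by (intro order_trans[OF scaled_resolvent_norm_le[OF T_selfadjoint \<mu>(1)]] mult_right_mono) auto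
  have \<tau>m: "filterlim (\<lambda>n. \<tau> (m n)) at_top sequentially"
    by (rule filterlim_compose[OF \<tau> filterlim_subseq[OF m(1)]])
  define q where "q n s = k s - indicator {- \<tau> (m n)<..<\<tau> (m n)} s *\<^sub>R cutoff (\<tau> (m n)) (k s)" for n s
  have "uniform_limit UNIV q (\<lambda>_. 0) sequentially"
    unfolding q_def[abs_def] by (rule truncated_C0_uniform_limit[OF \<tau>m k_C0])
  from uniform_limit_norm[OF this] have q: "uniform_limit UNIV (\<lambda>n s. norm (q n s)) (\<lambda>_. 0) sequentially"
    by simp
  from uniform_limit_norm[OF tail_uniform_limit[OF m(2) van]]
  have t: "uniform_limit UNIV (\<lambda>n s. norm (tail (m n) n s)) (\<lambda>_. 0) sequentially" by simp
  have "uniform_limit UNIV (\<lambda>n s. (\<bar>l\<bar> + M) * (norm (q n s) + (\<bar>l\<bar> + M) * norm (tail (m n) n s)))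
      (\<lambda>_. (\<bar>l\<bar> + M) * (0 + (\<bar>l\<bar> + M) * 0)) sequentially"
    by (intro uniform_limit_add bounded_linear.uniform_limit[OF bounded_linear_mult_right] q t)
  then have small: "uniform_limit UNIV (\<lambda>n s. (\<bar>l\<bar> + M) * (norm (q n s) + (\<bar>l\<bar> + M) * norm (tail (m n) n s)))
      (\<lambda>_. 0) sequentially" by simp
  have D: "uniform_limit UNIV (\<lambda>n s. (\<i> * complex_of_real (\<mu> n)) *\<^sub>C R (m n) n s - F n (k s)) (\<lambda>_. 0) sequentially"
  proof (rule uniform_limit_null_comparison[OF _ small], intro always_eventually allI ballI)
    fix n s
    have "norm ((\<i> * complex_of_real (\<mu> n)) *\<^sub>C R (m n) n s - F n (k s))
        \<le> (\<bar>l\<bar> + \<mu> n) * (norm (q n s) + (\<bar>l\<bar> + \<mu> n) * norm (tail (m n) n s))"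
      unfolding R_def tail_def cut_resolvent_def F_def q_def k_def
      by (rule cut_resolvent_diff_le[OF K T T_selfadjoint cut[OF m(2)] \<mu>(1)])
    also have "\<dots> \<le> (\<bar>l\<bar> + M) * (norm (q n s) + (\<bar>l\<bar> + M) * norm (tail (m n) n s))"
      using M[of n] \<mu>(1)[of n] by (intro mult_mono add_mono order_refl) auto
    finally show "norm ((\<i> * complex_of_real (\<mu> n)) *\<^sub>C R (m n) n s - F n (k s))
        \<le> (\<bar>l\<bar> + M) * (norm (q n s) + (\<bar>l\<bar> + M) * norm (tail (m n) n s))" .
  qed
  have Q: "bounded_linear (\<lambda>f. l *\<^sub>R E {1 / l} f)"
    using spectral_projection(1)[OF E T_bounded, of "{1 / l}"]
    by (intro bounded_linear_compose[OF bounded_linear_scaleR_right]) (simp add: bounded_op_def)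
  obtain C where C: "\<And>f. norm (l *\<^sub>R E {1 / l} f) \<le> norm f * C"
    using bounded_linear.bounded[OF Q] by blast
  have "uniform_limit UNIV (\<lambda>n s. F n (k s) - l *\<^sub>R E {1 / l} (k s)) (\<lambda>_. 0) sequentially"
  proof (rule uniform_limit_strong_C0[where F = "\<lambda>n f. F n f - l *\<^sub>R E {1 / l} f" and C = "\<bar>l\<bar> + M + C"])
    show "linear (\<lambda>f. F n f - l *\<^sub>R E {1 / l} f)" for n
      unfolding F_def using inv_fredholm_bounded_op[OF T_selfadjoint z[of n]]
      by (intro bounded_linear.linear bounded_linear_sub Q bounded_linear_compose[OF bounded_linear_cscale])
        (simp add: bounded_op_def)
    show "norm (F n f - l *\<^sub>R E {1 / l} f) \<le> (\<bar>l\<bar> + M + C) * norm f" for n f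
      using norm_triangle_ineq4[of "F n f" "l *\<^sub>R E {1 / l} f"] bound[of n f] C[of f]
      by (simp add: algebra_simps)
    show "(\<lambda>n. F n f - l *\<^sub>R E {1 / l} f) \<longlonglongrightarrow> 0" for f
      unfolding F_def by (rule LIM_zero[OF scaled_resolvent_tendsto[OF E T_bounded l \<mu>]])
  qed (rule k_C0)
  from uniform_limit_add[OF D this] show ?thesis
    by (simp add: uniform_limit_iff dist_norm)
qed

text \<open>The inner product is continuous in both arguments, so uniform convergence of the Carleman
  functions passes to the kernels; the remaining term of the resolvent kernel is the bounded kernel
  itself, multiplied by a null sequence.\<close>

lemma kernel_uniform_limit:
  assumes m: "strict_mono m" "\<And>n. m n \<ge> 1" and van: "vanishing_tails K \<tau> l \<mu> m"
  shows "uniform_limit UNIV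
    (\<lambda>n (s, t). - \<i> * complex_of_real (\<mu> n) * cut_resolvent K \<tau> (m n) (Complex l (\<mu> n)) s t)
    (\<lambda>(s, t). spectral_kernel E {1 / l} s t) sequentially"
proof -
  let ?r = "\<lambda>n. \<tau> (m n)"
  have \<tau>m: "filterlim ?r at_top sequentially"
    by (rule filterlim_compose[OF \<tau> filterlim_subseq[OF m(1)]])
  define g where "g n t = indicator {- ?r n<..<?r n} t *\<^sub>R cutoff (?r n) (k t)" for n t
  define h where "h n s = (\<i> * complex_of_real (\<mu> n)) *\<^sub>C R (m n) n s" for n s
  define H where "H s = l *\<^sub>R E {1 / l} (k s)" for s
  have h: "uniform_limit UNIV h H sequentially"
    unfolding h_def[abs_def] H_def[abs_def] by (rule carleman_uniform_limit[OF m van])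
  have "uniform_limit UNIV (\<lambda>n s. k s - (k s - g n s)) (\<lambda>s. k s - 0) sequentially"
    unfolding g_def by (intro uniform_limit_minus uniform_limit_const truncated_C0_uniform_limit \<tau>m k_C0)
  then have g: "uniform_limit UNIV g k sequentially" by simp
  have "H \<in> C0"
    unfolding H_def using spectral_projection(1)[OF E T_bounded, of "{1 / l}"]
    by (intro C0_linear[OF k_C0] bounded_linear_compose[OF bounded_linear_scaleR_right])
      (simp add: bounded_op_def)
  then have bd: "bounded (range H)" "bounded (range k)"
    using k_C0 C0_bounded by auto
  have "(\<lambda>(s, t). cinner (k t) (H s)) \<in> C0" by (rule C0_cinner[OF k_C0 \<open>H \<in> C0\<close>])
  then have bdc: "bounded (range (\<lambda>p. cinner (k (snd p)) (H (fst p))))"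
    using C0_bounded by (fastforce simp: case_prod_beta')
  have ip: "uniform_limit UNIV (\<lambda>n p. cinner (g n (snd p)) (h n (fst p)))
      (\<lambda>p. cinner (k (snd p)) (H (fst p))) sequentially"
  proof (rule bounded_bilinear.bounded_uniform_limit[OF bounded_bilinear_cinner])
    show "uniform_limit UNIV (\<lambda>n p. g n (snd p)) (\<lambda>p. k (snd p)) sequentially"
      by (rule uniform_limit_compose'[OF g]) auto
    show "uniform_limit UNIV (\<lambda>n p. h n (fst p)) (\<lambda>p. H (fst p)) sequentially"
      by (rule uniform_limit_compose'[OF h]) auto
    show "bounded (range (\<lambda>p. H (fst p)))" by (rule bounded_subset[OF bd(1)]) auto
    show "bounded (range (\<lambda>p. k (snd p)))" by (rule bounded_subset[OF bd(2)]) auto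
  qed
  have "(\<lambda>n. complex_of_real l + \<i> * complex_of_real (\<mu> n)) \<longlonglongrightarrow> complex_of_real l + \<i> * complex_of_real 0"
    by (intro tendsto_intros \<mu>)
  then have "(\<lambda>n. Complex l (\<mu> n)) \<longlonglongrightarrow> complex_of_real l"
    by (simp add: Complex_eq)
  then have z: "uniform_limit UNIV (\<lambda>n _ :: real \<times> real. Complex l (\<mu> n)) (\<lambda>_. complex_of_real l) sequentially"
    by (simp add: uniform_limit_iff tendsto_iff)
  have main: "uniform_limit UNIV (\<lambda>n p. Complex l (\<mu> n) * cinner (g n (snd p)) (h n (fst p)))
      (\<lambda>p. complex_of_real l * cinner (k (snd p)) (H (fst p))) sequentially"
    by (rule bounded_bilinear.bounded_uniform_limit[OF bounded_bilinear_mult z ip bdc])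
      (auto intro: finite_imp_bounded)
  have "case_prod K \<in> C0" using K by (simp add: K0_kernel_def)
  then obtain B where B: "\<And>p. norm (case_prod K p) \<le> B"
    using C0_bounded[of "case_prod K"] unfolding bounded_iff by blast
  have rest: "uniform_limit UNIV
      (\<lambda>n p. - \<i> * complex_of_real (\<mu> n) * square_cut (?r n) K (fst p) (snd p)) (\<lambda>_. 0) sequentially"
  proof (rule uniform_limit_null_comparison)
    have "(\<lambda>n. \<mu> n * B) \<longlonglongrightarrow> 0 * B" by (intro tendsto_intros \<mu>)
    then show "uniform_limit UNIV (\<lambda>n _. \<mu> n * B) (\<lambda>_. 0) sequentially"
      by (simp add: uniform_limit_iff tendsto_iff)
    have "norm (square_cut (?r n) K s t) \<le> B" for n s t
    proof -
      have "norm (square_cut (?r n) K s t) \<le> norm (K s t)"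
        by (simp add: square_cut_def indicator_def)
      then show ?thesis using B[of "(s, t)"] by simp
    qed
    then show "\<forall>\<^sub>F n in sequentially. \<forall>p\<in>UNIV.
        norm (- \<i> * complex_of_real (\<mu> n) * square_cut (?r n) K (fst p) (snd p)) \<le> \<mu> n * B"
      using \<mu>(1) by (intro always_eventually allI ballI) (simp add: norm_mult mult_left_mono less_imp_le)
  qed
  have "- \<i> * complex_of_real (\<mu> n) * cut_resolvent K \<tau> (m n) (Complex l (\<mu> n)) s t
      = - \<i> * complex_of_real (\<mu> n) * square_cut (?r n) K s t + Complex l (\<mu> n) * cinner (g n t) (h n s)" for n s t
  proof -
    have "cut_resolvent K \<tau> (m n) (Complex l (\<mu> n)) s t
        = square_cut (?r n) K s t + Complex l (\<mu> n) * cinner (g n t) (R (m n) n s)"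
      unfolding cut_resolvent_def R_def g_def k_def
      by (rule cut_resolvent_kernel(3)[OF K T T_selfadjoint cut[OF m(2)] \<mu>(1)])
    then show ?thesis by (simp add: h_def cinner_scale_right algebra_simps)
  qed
  then show ?thesis
    using uniform_limit_add[OF rest main]
    by (simp add: case_prod_beta' spectral_kernel_eq(4)[OF K T E l] k_def H_def)
qed

lemma spectral_kernel_zero_iff:
  "(\<forall>s t. spectral_kernel E {1 / l} s t = 0) \<longleftrightarrow> (\<forall>f. E {1 / l} f = 0)"
proof
  assume zero: "\<forall>s t. spectral_kernel E {1 / l} s t = 0"
  note S = spectral_kernel_eq(2)[OF K T E l]
  show "\<forall>f. E {1 / l} f = 0"
  proof
    fix f
    have "AE s in lborel. rep_L2 (E {1 / l} f) s = 0"
      using S zero by (simp add: induces_def)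
    then have "(\<integral>s. (cmod (rep_L2 (E {1 / l} f) s))\<^sup>2 \<partial>lborel) = 0"
      by (intro integral_eq_zero_AE) auto
    then show "E {1 / l} f = 0" using norm_square_integral[of "E {1 / l} f"] by simp
  qed
qed (simp add: spectral_kernel_eq(4)[OF K T E l])

text \<open>The range of \<open>E {1 / l}\<close> is the kernel of \<open>I - l T\<close>, and when it is trivial the range of \<open>I - l T\<close>
  is dense, which leaves no room for other parts of the characteristic set at real points.\<close>

lemma spectral_atom_zero_iff:
  shows "(\<forall>f. E {1 / l} f = 0) \<longleftrightarrow>
      complex_of_real l \<in> continuous_characteristic_set T \<union> regular_values T"
    and "(\<exists>f. E {1 / l} f \<noteq> 0) \<longleftrightarrow> complex_of_real l \<in> point_characteristic_set T"
proof -
  let ?Q = "E {1 / l}" and ?l = "complex_of_real l"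
  note ker_iff = fredholm_kernel_iff_spectral[OF E T_bounded l]
  have Q: "bounded_op ?Q" "?Q (?Q f) = ?Q f" for f
    using spectral_projection(1)[OF E T_bounded, of "{1 / l}"]
      spectral_inter[OF E T_bounded, of "{1 / l}" "{1 / l}" f] by auto
  have ker: "{f. fredholm T ?l f = 0} = {0} \<longleftrightarrow> (\<forall>f. ?Q f = 0)"
  proof
    assume "{f. fredholm T ?l f = 0} = {0}"
    then show "\<forall>f. ?Q f = 0" using ker_iff Q(2) by blast
  next
    assume "\<forall>f. ?Q f = 0"
    then show "{f. fredholm T ?l f = 0} = {0}" by (auto simp: ker_iff)
  qed
  have reg: "{f. fredholm T ?l f = 0} = {0}" if l_reg: "?l \<in> regular_values T"
  proof -
    obtain B where B: "bounded_op B" "B \<circ> fredholm T ?l = id"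
      using l_reg by (auto simp: regular_values_def)
    have "f = 0" if "fredholm T ?l f = 0" for f
      using fun_cong[OF B(2), of f] B(1) that by (simp add: bounded_op_def linear_simps)
    moreover have "fredholm T ?l 0 = 0"
      using T_bounded by (simp add: fredholm_def bounded_op_def linear_simps)
    ultimately show ?thesis by auto
  qed
  show "(\<forall>f. ?Q f = 0) \<longleftrightarrow> ?l \<in> continuous_characteristic_set T \<union> regular_values T"
    using ker reg dense_range_of_trivial_atom[OF E T_bounded l]
    by (auto simp: continuous_characteristic_set_def characteristic_set_def)
  show "(\<exists>f. ?Q f \<noteq> 0) \<longleftrightarrow> ?l \<in> point_characteristic_set T"
    using ker reg by (auto simp: point_characteristic_set_def characteristic_set_def)
qed

lemma resolvents_converge_of_vanishing_tails:
  assumes m: "strict_mono m" "\<And>n. m n \<ge> 1" and van: "vanishing_tails K \<tau> l \<mu> m"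
  shows "resolvents_converge K T E \<tau> l \<mu> m"
proof -
  let ?L = "\<lambda>n. cut_resolvent K \<tau> (m n) (Complex l (\<mu> n))" and ?S = "spectral_kernel E {1 / l}"
  note S = spectral_kernel_eq[OF K T E l]
  have L: "K0_kernel (?L n)" for n
    unfolding cut_resolvent_def by (rule cut_resolvent_kernel(1)[OF K T T_selfadjoint cut[OF m(2)] \<mu>(1)])
  have LC: "carleman (?L n) \<in> C0" "case_prod (?L n) \<in> C0" for n
    using L by (auto simp: K0_kernel_def)
  have SC: "carleman ?S \<in> C0" "case_prod ?S \<in> C0"
    using S(1) by (auto simp: K0_kernel_def)
  have 1: "C0_tendsto (\<lambda>n s. (\<i> * complex_of_real (\<mu> n)) *\<^sub>C carleman (?L n) s) (carleman ?S)"
  proof (rule C0_tendstoI)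
    show "uniform_limit UNIV (\<lambda>n s. (\<i> * complex_of_real (\<mu> n)) *\<^sub>C carleman (?L n) s) (carleman ?S) sequentially"
      using carleman_uniform_limit[OF m van] by (simp add: R_def k_def S(3)[abs_def])
  qed (intro C0_linear[OF LC(1) bounded_linear_cscale] SC)+
  have 2: "C0_tendsto (\<lambda>n (s, t). - \<i> * complex_of_real (\<mu> n) * ?L n s t) (\<lambda>(s, t). ?S s t)"
  proof (rule C0_tendstoI)
    show "(\<lambda>(s, t). - \<i> * complex_of_real (\<mu> n) * ?L n s t) \<in> C0" for n
      using C0_linear[OF LC(2)[of n] bounded_linear_mult_right[of "- \<i> * complex_of_real (\<mu> n)"]]
      by (simp add: case_prod_beta')
  qed (use SC kernel_uniform_limit[OF m van] in simp_all)
  have "sup_norm (\<lambda>(s, t). - \<i> * complex_of_real (\<mu> n) * ?L n s t) = \<mu> n * sup_norm (\<lambda>(s, t). ?L n s t)" for n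
    using \<mu>(1)[of n] C0_bounded[OF LC(2)[of n]]
    by (intro sup_norm_scale) (auto simp: norm_mult)
  with sup_norm_tendsto[OF 2]
  have 3: "(\<lambda>n. \<mu> n * sup_norm (\<lambda>(s, t). ?L n s t)) \<longlonglongrightarrow> sup_norm (\<lambda>(s, t). ?S s t)" by simp
  have le: "norm (?S s t) \<le> sup_norm (\<lambda>(s, t). ?S s t)" for s t
    using norm_le_sup_norm[OF C0_bounded[OF SC(2)], of "(s, t)"] by simp
  have nonneg: "0 \<le> sup_norm (\<lambda>(s, t). ?S s t)"
    using norm_ge_zero le order_trans by blast
  have zero: "sup_norm (\<lambda>(s, t). ?S s t) = 0 \<longleftrightarrow> (\<forall>f. E {1 / l} f = 0)"
    unfolding spectral_kernel_zero_iff[symmetric]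
  proof
    assume "sup_norm (\<lambda>(s, t). ?S s t) = 0"
    then show "\<forall>s t. ?S s t = 0" using le by simp
  next
    assume "\<forall>s t. ?S s t = 0"
    then show "sup_norm (\<lambda>(s, t). ?S s t) = 0" by (simp add: sup_norm_def case_prod_beta')
  qed
  then have pos: "sup_norm (\<lambda>(s, t). ?S s t) > 0 \<longleftrightarrow> (\<exists>f. E {1 / l} f \<noteq> 0)"
    using nonneg by auto
  show ?thesis
    unfolding resolvents_converge_def Let_def
    using 1 2 3 zero pos spectral_atom_zero_iff by blast
qed

end

theorem theorem8:
  fixes K :: "real \<Rightarrow> real \<Rightarrow> complex"
    and T :: "L2 \<Rightarrow> L2"
    and E :: "real set \<Rightarrow> L2 \<Rightarrow> L2"
    and \<tau> \<mu> :: "nat \<Rightarrow> real"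
    and l :: real
  assumes "K0_kernel K" and "induces K T"
    and "\<And>n. n \<ge> 1 \<Longrightarrow> \<tau> n > 0"
    and "strict_mono_on {1..} \<tau>"
    and "filterlim \<tau> at_top sequentially"
    and "\<And>n. n \<ge> 1 \<Longrightarrow> K0_kernel (row_cut (\<tau> n) K)"
    and "\<And>n. n \<ge> 1 \<Longrightarrow> K0_kernel (square_cut (\<tau> n) K)"
    and "\<And>n. n \<ge> 1 \<Longrightarrow> nuclear (cutoff (\<tau> n) \<circ> T)"
    and "\<And>n. n \<ge> 1 \<Longrightarrow> nuclear (cutoff (\<tau> n) \<circ> T \<circ> cutoff (\<tau> n))"
    and "hermitian_kernel K"
    and "resolution_of_identity T E"
    and "l \<noteq> 0"
    and "\<And>n. \<mu> n > 0" and "decseq \<mu>" and "\<mu> \<longlonglongrightarrow> 0"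
  shows "(\<exists>m :: nat \<Rightarrow> nat. strict_mono m \<and> (\<forall>n. m n \<ge> 1) \<and>
            resolvents_converge K T E \<tau> l \<mu> m) \<and>
         (\<exists>m :: nat \<Rightarrow> nat. strict_mono m \<and> (\<forall>n. m n \<ge> 1) \<and>
            vanishing_tails K \<tau> l \<mu> m) \<and>
         (\<forall>m :: nat \<Rightarrow> nat. strict_mono m \<and> (\<forall>n. m n \<ge> 1) \<and>
            vanishing_tails K \<tau> l \<mu> m \<longrightarrow> resolvents_converge K T E \<tau> l \<mu> m)"
proof -
  have exist: "\<exists>m :: nat \<Rightarrow> nat. strict_mono m \<and> (\<forall>n. m n \<ge> 1) \<and> vanishing_tails K \<tau> l \<mu> m"
    by (rule vanishing_tails_exist) (use assms in auto)
  moreover have "\<forall>m :: nat \<Rightarrow> nat. strict_mono m \<and> (\<forall>n. m n \<ge> 1) \<and>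
      vanishing_tails K \<tau> l \<mu> m \<longrightarrow> resolvents_converge K T E \<tau> l \<mu> m"
    by (intro allI impI, rule resolvents_converge_of_vanishing_tails) (use assms in auto)
  ultimately show ?thesis by blast
qed

end
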